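(* Let $r\ge 2$ and $s\ge 1$ be integers. Then: (1) if $s$ is even and $rs\not\equiv 0\pmod 4$, $\chi_{la}(DF^1(r,2s))=3$; (2) if $s$ is even and $r\not\equiv 0\pmod 4$, $\chi_{la}(DF^2(r,2s))=3$; (3) $\chi_{la}(DF^3(r,2s))=3$; (4) if $r$ is even, $\chi_{la}(DF^4(r,2s))=3$.
   Context: For a graph $G=(V,E)$ with $|E|=m$ and no isolated vertices, a local antimagic labeling is a bijection $f:E\to\{1,\dots,m\}$ such that $f^+(u)\ne f^+(v)$ for every edge $uv$, where $f^+(x)=\sum f(e)$ over all edges $e$ incident to $x$. The local antimagic chromatic number $\chi_{la}(G)$ is the minimum, over all local antimagic labelings $f$ of $G$, of the number of distinct values taken by $f^+$ (also for disconnected graphs). Merging a set of vertices means identifying them into a single vertex incident to all edges previously incident to any of them. Let $rDF(2s)$ be the graph with components indexed by $j=1,\dots,r$, where component $j$ consists of: paths $u^1_{j,a}w^1_{j,a}v^1_{j,a}$ and $u^2_{j,a}w^2_{j,a}v^2_{j,a}$ for $1\le a\le s$, a vertex $y_j$ adjacent to $w^1_{j,a},u^2_{j,a},v^2_{j,a}$ for all $a$, and a vertex $z_j$ adjacent to $u^1_{j,a},v^1_{j,a},w^2_{j,a}$ for all $a$ (each component is a diamond fan $DF(2s)$). Define: $DF^1(r,2s)$ is obtained from $rDF(2s)$ by merging, for each $1\le a\le s$, the vertices $\{w^1_{j,a}:1\le j\le r\}$ into one vertex and $\{w^2_{j,a}:1\le j\le r\}$ into one vertex. $DF^2(r,2s)$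 is obtained by merging, for each $1\le a\le s$, each of the four sets $\{u^1_{j,a}:1\le j\le r\}$, $\{u^2_{j,a}:1\le j\le r\}$, $\{v^1_{j,a}:1\le j\le r\}$, $\{v^2_{j,a}:1\le j\le r\}$ into one vertex. $DF^3(r,2s)$ is obtained by merging $\{y_j:1\le j\le r\}$ into one vertex $y$ and $\{z_j:1\le j\le r\}$ into one vertex $z$. For even $r$, $DF^4(r,2s)$ is obtained by merging, for each $1\le j\le r$, $y_j$ with $z_{j+1}$ (indices mod $r$, $z_{r+1}=z_1$) into a vertex of degree $6s$. *)

theory Defs
  imports Complex_Main
begin

section \<open>Local antimagic labelings\<close>

text \<open>An edge is the set of its two end vertices.\<close>

record 'v ugraph =
  verts :: "'v set"
  edges :: "'v set set"

definition simple_graph :: "'v ugraph \<Rightarrow> bool" where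
  "simple_graph G \<longleftrightarrow>
     finite (verts G) \<and> (\<forall>e \<in> edges G. e \<subseteq> verts G \<and> card e = 2)"

definition no_isolated :: "'v ugraph \<Rightarrow> bool" where
  "no_isolated G \<longleftrightarrow> (\<forall>x \<in> verts G. \<exists>e \<in> edges G. x \<in> e)"

definition vertex_sum :: "'v ugraph \<Rightarrow> ('v set \<Rightarrow> nat) \<Rightarrow> 'v \<Rightarrow> nat" where
  "vertex_sum G f x = (\<Sum>e \<in> {e \<in> edges G. x \<in> e}. f e)"

definition local_antimagic :: "'v ugraph \<Rightarrow> ('v set \<Rightarrow> nat) \<Rightarrow> bool" where
  "local_antimagic G f \<longleftrightarrow>
     bij_betw f (edges G) {1..card (edges G)} \<and>
     (\<forall>u v. {u, v} \<in> edges G \<longrightarrow> vertex_sum G f u \<noteq> vertex_sum G f v)"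

text \<open>
  On the natural numbers \<^term>\<open>Inf\<close> of a nonempty set is its minimum, and \<^term>\<open>Inf {} = (0::nat)\<close>.
  So the value 0 stands for ``no local antimagic labeling exists'' (or for a graph without vertices),
  and a positive value is always attained by a labeling.
\<close>

definition chi_la :: "'v ugraph \<Rightarrow> nat" where
  "chi_la G = Inf {card (vertex_sum G f ` verts G) | f. local_antimagic G f}"


section \<open>Merging vertices\<close>

text \<open>
  \<open>P\<close> is a family of pairwise disjoint vertex sets, each of which is identified to one vertex.
  A vertex of the merged graph is represented by the set of the original vertices that it
  consists of; a vertex lying in no member of \<open>P\<close> becomes a singleton. Since edges are sets of
  vertices, this is the right notion of merging only when no loops or parallel edges arise; for
  the graphs below this is shown by \<open>simple_graph_DF\<close> and \<open>merge_inj_edges\<close>.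
\<close>

definition merge_class :: "'v set set \<Rightarrow> 'v \<Rightarrow> 'v set" where
  "merge_class P x = insert x (\<Union> {S \<in> P. x \<in> S})"

definition merge :: "'v set set \<Rightarrow> 'v ugraph \<Rightarrow> 'v set ugraph" where
  "merge P G = \<lparr> verts = merge_class P ` verts G,
                 edges = (\<lambda>e. merge_class P ` e) ` edges G \<rparr>"


section \<open>Diamond fans\<close>

text \<open>\<open>U i j a\<close> stands for the vertex \<open>u\<close> with superscript \<open>i\<close> and subscripts \<open>j\<close>, \<open>a\<close>; likewise
  \<open>V\<close> and \<open>W\<close>.\<close>

datatype df_vertex = U nat nat nat | V nat nat nat | W nat nat nat | Y nat | Z nat

definition rDF :: "nat \<Rightarrow> nat \<Rightarrow> df_vertex ugraph" where
  "rDF r s = \<lparr>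
     verts = (\<Union>i \<in> {1, 2}. \<Union>j \<in> {1..r}. \<Union>a \<in> {1..s}. {U i j a, V i j a, W i j a})
           \<union> (\<Union>j \<in> {1..r}. {Y j, Z j}),
     edges = (\<Union>j \<in> {1..r}. \<Union>a \<in> {1..s}.
       {{U 1 j a, W 1 j a}, {W 1 j a, V 1 j a},
        {U 2 j a, W 2 j a}, {W 2 j a, V 2 j a},
        {Y j, W 1 j a}, {Y j, U 2 j a}, {Y j, V 2 j a},
        {Z j, U 1 j a}, {Z j, V 1 j a}, {Z j, W 2 j a}}) \<rparr>"

definition parts1 :: "nat \<Rightarrow> nat \<Rightarrow> df_vertex set set" where
  "parts1 r s = (\<Union>a \<in> {1..s}. {{W 1 j a | j. j \<in> {1..r}}, {W 2 j a | j. j \<in> {1..r}}})"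

definition parts2 :: "nat \<Rightarrow> nat \<Rightarrow> df_vertex set set" where
  "parts2 r s = (\<Union>a \<in> {1..s}.
     {{U 1 j a | j. j \<in> {1..r}}, {U 2 j a | j. j \<in> {1..r}},
      {V 1 j a | j. j \<in> {1..r}}, {V 2 j a | j. j \<in> {1..r}}})"

definition parts3 :: "nat \<Rightarrow> df_vertex set set" where
  "parts3 r = {{Y j | j. j \<in> {1..r}}, {Z j | j. j \<in> {1..r}}}"

definition parts4 :: "nat \<Rightarrow> df_vertex set set" where
  "parts4 r = {{Y j, Z (if j = r then 1 else j + 1)} | j. j \<in> {1..r}}"

definition DF1 :: "nat \<Rightarrow> nat \<Rightarrow> df_vertex set ugraph" where
  "DF1 r s = merge (parts1 r s) (rDF r s)"

definition DF2 :: "nat \<Rightarrow> nat \<Rightarrow> df_vertex set ugraph" where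
  "DF2 r s = merge (parts2 r s) (rDF r s)"

definition DF3 :: "nat \<Rightarrow> nat \<Rightarrow> df_vertex set ugraph" where
  "DF3 r s = merge (parts3 r) (rDF r s)"

definition DF4 :: "nat \<Rightarrow> nat \<Rightarrow> df_vertex set ugraph" where
  "DF4 r s = merge (parts4 r) (rDF r s)"

section \<open>Merging creates no loops or parallel edges here\<close>

lemma merge_class_factor:
  assumes "\<And>S x y. S \<in> P \<Longrightarrow> x \<in> S \<Longrightarrow> y \<in> S \<Longrightarrow> q x = q y"
  shows "the_elem (q ` merge_class P x) = q x"
proof -
  have "q y = q x" if "y \<in> merge_class P x" for y
    using that assms unfolding merge_class_def by blast
  moreover have "x \<in> merge_class P x"
    by (simp add: merge_class_def)
  ultimately have "q ` merge_class P x = {q x}"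
    by blast
  then show ?thesis by simp
qed

lemma merge_injI:
  assumes q: "\<And>S x y. S \<in> P \<Longrightarrow> x \<in> S \<Longrightarrow> y \<in> S \<Longrightarrow> q x = q y"
    and inj: "inj_on ((`) q) (edges G)"
    and loops: "\<And>e. e \<in> edges G \<Longrightarrow> inj_on q e"
    and G: "simple_graph G"
  shows "inj_on ((`) (merge_class P)) (edges G)" "simple_graph (merge P G)"
proof -
  define h where "h = (\<lambda>S. the_elem (q ` S))"
  have h: "h (merge_class P x) = q x" for x
    using merge_class_factor[of P q x] q unfolding h_def by blast
  have him: "h ` merge_class P ` e = q ` e" for e
    by (simp add: image_image h)
  show "inj_on ((`) (merge_class P)) (edges G)"
  proof (rule inj_onI)
    fix e e' assume e: "e \<in> edges G" "e' \<in> edges G" "merge_class P ` e = merge_class P ` e'"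
    have "q ` e = q ` e'" using him[of e] him[of e'] e(3) by simp
    then show "e = e'" using inj_onD[OF inj] e by blast
  qed
  have "inj_on (merge_class P) e" if "e \<in> edges G" for e
    using loops[OF that] h by (metis (no_types, lifting) inj_on_def)
  then show "simple_graph (merge P G)"
    using G unfolding simple_graph_def merge_def by (auto simp: card_image)
qed

text \<open>\<open>repk\<close> is constant on each set that is merged in \<open>DFk\<close>.\<close>

fun rep1 :: "df_vertex \<Rightarrow> df_vertex" where
  "rep1 (W i j a) = W i 1 a"
| "rep1 x = x"

fun rep2 :: "df_vertex \<Rightarrow> df_vertex" where
  "rep2 (U i j a) = U i 1 a"
| "rep2 (V i j a) = V i 1 a"
| "rep2 x = x"

fun rep3 :: "df_vertex \<Rightarrow> df_vertex" where
  "rep3 (Y j) = Y 1"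
| "rep3 (Z j) = Z 1"
| "rep3 x = x"

fun rep4 :: "nat \<Rightarrow> df_vertex \<Rightarrow> df_vertex" where
  "rep4 r (Z k) = Y (if k = 1 then r else k - 1)"
| "rep4 r x = x"

lemma simple_graph_rDF: "simple_graph (rDF r s)"
  by (auto simp: simple_graph_def rDF_def)

lemma rep1_inj:
  "inj_on ((`) rep1) (edges (rDF r s))" "e \<in> edges (rDF r s) \<Longrightarrow> inj_on rep1 e"
  by (rule inj_onI; clarsimp simp: rDF_def; elim disjE; force simp: doubleton_eq_iff)
     (auto simp: rDF_def inj_on_def)

lemma rep2_inj:
  "inj_on ((`) rep2) (edges (rDF r s))" "e \<in> edges (rDF r s) \<Longrightarrow> inj_on rep2 e"
  by (rule inj_onI; clarsimp simp: rDF_def; elim disjE; force simp: doubleton_eq_iff)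
     (auto simp: rDF_def inj_on_def)

lemma rep3_inj:
  "inj_on ((`) rep3) (edges (rDF r s))" "e \<in> edges (rDF r s) \<Longrightarrow> inj_on rep3 e"
  by (rule inj_onI; clarsimp simp: rDF_def; elim disjE; force simp: doubleton_eq_iff)
     (auto simp: rDF_def inj_on_def)

lemma rep4_inj:
  "inj_on ((`) (rep4 r)) (edges (rDF r s))" "e \<in> edges (rDF r s) \<Longrightarrow> inj_on (rep4 r) e"
  by (rule inj_onI; clarsimp simp: rDF_def; elim disjE; force simp: doubleton_eq_iff)
     (auto simp: rDF_def inj_on_def)

lemma parts_rep:
  "S \<in> parts1 r s \<Longrightarrow> x \<in> S \<Longrightarrow> y \<in> S \<Longrightarrow> rep1 x = rep1 y"
  "S \<in> parts2 r s \<Longrightarrow> x \<in> S \<Longrightarrow> y \<in> S \<Longrightarrow> rep2 x = rep2 y"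
  "S \<in> parts3 r \<Longrightarrow> x \<in> S \<Longrightarrow> y \<in> S \<Longrightarrow> rep3 x = rep3 y"
  "S \<in> parts4 r \<Longrightarrow> x \<in> S \<Longrightarrow> y \<in> S \<Longrightarrow> rep4 r x = rep4 r y"
  by (auto simp: parts1_def parts2_def parts3_def parts4_def)

lemma merge_inj_edges:
  "inj_on ((`) (merge_class (parts1 r s))) (edges (rDF r s))"
  "inj_on ((`) (merge_class (parts2 r s))) (edges (rDF r s))"
  "inj_on ((`) (merge_class (parts3 r))) (edges (rDF r s))"
  "inj_on ((`) (merge_class (parts4 r))) (edges (rDF r s))"
  by (rule merge_injI(1)[OF parts_rep(1) rep1_inj simple_graph_rDF]
      merge_injI(1)[OF parts_rep(2) rep2_inj simple_graph_rDF]
      merge_injI(1)[OF parts_rep(3) rep3_inj simple_graph_rDF]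
      merge_injI(1)[OF parts_rep(4) rep4_inj simple_graph_rDF]; assumption)+

lemma simple_graph_DF:
  "simple_graph (DF1 r s)" "simple_graph (DF2 r s)" "simple_graph (DF3 r s)"
  "simple_graph (DF4 r s)"
  unfolding DF1_def DF2_def DF3_def DF4_def
  by (rule merge_injI(2)[OF parts_rep(1) rep1_inj simple_graph_rDF]
      merge_injI(2)[OF parts_rep(2) rep2_inj simple_graph_rDF]
      merge_injI(2)[OF parts_rep(3) rep3_inj simple_graph_rDF]
      merge_injI(2)[OF parts_rep(4) rep4_inj simple_graph_rDF]; assumption)+

lemma no_isolated_DF:
  assumes "s \<ge> 1"
  shows "no_isolated (rDF r s)" "no_isolated (DF1 r s)" "no_isolated (DF2 r s)"
    "no_isolated (DF3 r s)" "no_isolated (DF4 r s)"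
proof -
  show *: "no_isolated (rDF r s)"
    using assms unfolding no_isolated_def rDF_def by fastforce
  then have "no_isolated (merge P (rDF r s))" for P
    unfolding no_isolated_def merge_def by fastforce
  then show "no_isolated (DF1 r s)" "no_isolated (DF2 r s)"
    "no_isolated (DF3 r s)" "no_isolated (DF4 r s)"
    by (simp_all add: DF1_def DF2_def DF3_def DF4_def)
qed

end

theory Submission
  imports Defs
begin

text \<open>
  Let \<open>n = rs\<close> and \<open>M = 10n + 1\<close>, so that \<open>k \<mapsto> M - k\<close> permutes the labels. Give the two edges at
  each vertex \<open>u\<close>, \<open>v\<close> complementary labels, likewise the two edges joining \<open>w\<^sup>1\<close>, \<open>w\<^sup>2\<close> to \<open>y\<close>, \<open>z\<close>,
  and let every \<open>w\<close> have the same sum \<open>c\<close>. Then every \<open>u\<close>, \<open>v\<close> has sum \<open>M\<close>, and automatically every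
  \<open>y\<close> and \<open>z\<close> has sum \<open>s(3M - c)\<close>. Merging therefore only multiplies one of these three values, and the
  parity conditions keep them distinct. What is needed is to split the \<open>5n\<close> complementary pairs into \<open>n\<close>
  quintuples with representatives satisfying \<open>w + A + B = c = (M - w) + C + E\<close>, which arithmetic
  progressions achieve.

  Three values are necessary because a symmetry of the graph (exchanging the superscripts 1 and 2 together
  with \<open>y\<close> and \<open>z\<close>, or, in \<open>DF\<^sup>4\<close>, rotating the components) interchanges the two classes of every proper
  2-colouring.
\<close>

section \<open>Splitting the labels into quintuples\<close>

text \<open>The slopes 1, 1, -2 of \<open>w\<close>, \<open>A\<close>, \<open>B\<close> and -1, 2,
  -1 of the complement of \<open>w\<close>, of \<open>C\<close> and of \<open>E\<close> cancel, so
  both sums are constant; the jumps at \<open>t = q\<close> cancel as well. Only covering is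
  claimed: five columns of \<open>2 * q\<close> labels meet all \<open>10 * q\<close> complementary
  pairs, and injectivity comes later by counting.\<close>

lemma labels_even:
  fixes q :: nat
  obtains w A B C E :: "nat \<Rightarrow> nat" where
    "\<And>t. t < 2 * q \<Longrightarrow> {w t, A t, B t, C t, E t} \<subseteq> {1..20 * q}"
    "\<And>t. t < 2 * q \<Longrightarrow> w t + A t + B t = 30 * q + 1"
    "\<And>t. t < 2 * q \<Longrightarrow> (20 * q + 1 - w t) + C t + E t = 30 * q + 1"
    "\<And>k. k \<in> {1..20 * q} \<Longrightarrow>
       \<exists>t<2 * q. k \<in> {w t, A t, B t, C t, E t} \<or> 20 * q + 1 - k \<in> {w t, A t, B t, C t, E t}"
proof
  let ?w = "\<lambda>t. if t < q then 14 * q + 1 + t else 18 * q + 1 + t"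
  let ?A = "\<lambda>t. if t < q then 4 * q + 1 + t else t + 1"
  let ?B = "\<lambda>t. 12 * q - 1 - 2 * t"
  let ?C = "\<lambda>t. if t < q then 6 * q + 1 + 2 * t else 10 * q + 1 + 2 * t"
  let ?E = "\<lambda>t. 18 * q - t"
  show "{?w t, ?A t, ?B t, ?C t, ?E t} \<subseteq> {1..20 * q}" if "t < 2 * q" for t
    using that by auto
  show "?w t + ?A t + ?B t = 30 * q + 1" if "t < 2 * q" for t
    using that by auto
  show "(20 * q + 1 - ?w t) + ?C t + ?E t = 30 * q + 1" if "t < 2 * q" for t
    using that by auto
  fix k assume k: "k \<in> {1..20 * q}"
  let ?P = "\<lambda>l. \<exists>t<2 * q. l \<in> {?w t, ?A t, ?B t, ?C t, ?E t}"
  have up: "?P l \<or> ?P (20 * q + 1 - l)" if l: "l \<in> {10 * q + 1..20 * q}" for l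
  proof -
    \<comment> \<open>The columns and their complements tile the upper half. In order:
      \<open>B\<close> for \<open>t < q\<close>, complement of \<open>B\<close> for
      \<open>t \<ge> q\<close>, \<open>C\<close> for \<open>t \<ge> q\<close>, complement of
      \<open>C\<close> for \<open>t < q\<close>, \<open>w\<close> and then complement of
      \<open>A\<close> for \<open>t < q\<close>, all of \<open>E\<close>, complement of
      \<open>A\<close> and then \<open>w\<close> for \<open>t \<ge> q\<close>.\<close>
    consider (1) "l \<le> 12 * q" "odd l" | (2) "l \<le> 12 * q" "even l"
      | (3) "12 * q < l" "l \<le> 14 * q" "odd l" | (4) "12 * q < l" "l \<le> 14 * q" "even l"
      | (5) "14 * q < l" "l \<le> 15 * q" | (6) "15 * q < l" "l \<le> 16 * q"
      | (7) "16 * q < l" "l \<le> 18 * q" | (8) "18 * q < l" "l \<le> 19 * q" | (9) "19 * q < l"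
      by linarith
    then show ?thesis
    proof cases
      case 1
      then obtain m where "l = 2 * m + 1" by (elim oddE)
      with 1 l have "6 * q - 1 - m < q" "l = ?B (6 * q - 1 - m)" by auto
      then show ?thesis by (intro disjI1 exI[of _ "6 * q - 1 - m"]) auto
    next
      case 2
      then obtain m where "l = 2 * m" by (elim evenE)
      with 2 l have "m - 1 - 4 * q < 2 * q" "\<not> m - 1 - 4 * q < q" "20 * q + 1 - l = ?B (m - 1 - 4 * q)"
        by auto
      then show ?thesis by (intro disjI2 exI[of _ "m - 1 - 4 * q"]) auto
    next
      case 3
      then obtain m where "l = 2 * m + 1" by (elim oddE)
      with 3 l have "m - 5 * q < 2 * q" "\<not> m - 5 * q < q" "l = ?C (m - 5 * q)" by auto
      then show ?thesis by (intro disjI1 exI[of _ "m - 5 * q"]) auto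
    next
      case 4
      then obtain m where "l = 2 * m" by (elim evenE)
      with 4 l have "7 * q - m < q" "20 * q + 1 - l = ?C (7 * q - m)" by auto
      then show ?thesis by (intro disjI2 exI[of _ "7 * q - m"]) auto
    next
      case 5
      with l show ?thesis by (intro disjI1 exI[of _ "l - 14 * q - 1"]) auto
    next
      case 6
      with l show ?thesis by (intro disjI2 exI[of _ "16 * q - l"]) auto
    next
      case 7
      with l show ?thesis by (intro disjI1 exI[of _ "18 * q - l"]) auto
    next
      case 8
      with l show ?thesis by (intro disjI2 exI[of _ "20 * q - l"]) auto
    next
      case 9
      with l show ?thesis by (intro disjI1 exI[of _ "l - 18 * q - 1"]) auto
    qed
  qed
  \<comment> \<open>The claim is invariant under complementation, which exchanges the lower and the
    upper half.\<close>
  have "?P k \<or> ?P (20 * q + 1 - k)"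
  proof (cases "k \<le> 10 * q")
    case True
    with k have "20 * q + 1 - k \<in> {10 * q + 1..20 * q}" "20 * q + 1 - (20 * q + 1 - k) = k" by auto
    then show ?thesis using up[of "20 * q + 1 - k"] by metis
  next
    case False
    with k show ?thesis by (intro up) auto
  qed
  then show "\<exists>t<2 * q. k \<in> {?w t, ?A t, ?B t, ?C t, ?E t}
      \<or> 20 * q + 1 - k \<in> {?w t, ?A t, ?B t, ?C t, ?E t}"
    by blast
qed

text \<open>The upper half splits into five intervals of length \<open>n\<close>, filled in
  ascending order by the complement of \<open>E\<close>, then \<open>w\<close>, \<open>C\<close>,
  \<open>A\<close>, and the complement of \<open>B\<close>. Each column runs through its interval
  along one of three permutations of \<open>{0..2 * h}\<close>.\<close>

lemma labels_odd:
  fixes h n :: nat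
  assumes n: "n = 2 * h + 1"
  obtains w A B C E :: "nat \<Rightarrow> nat" where
    "\<And>t. t < n \<Longrightarrow> {w t, A t, B t, C t, E t} \<subseteq> {1..10 * n}"
    "\<And>t. t < n \<Longrightarrow> w t + A t + B t = 31 * h + 17"
    "\<And>t. t < n \<Longrightarrow> (10 * n + 1 - w t) + C t + E t = 31 * h + 17"
    "\<And>k. k \<in> {1..10 * n} \<Longrightarrow>
       \<exists>t<n. k \<in> {w t, A t, B t, C t, E t} \<or> 10 * n + 1 - k \<in> {w t, A t, B t, C t, E t}"
proof
  \<comment> \<open>The first lists the even numbers and then the odd ones; \<open>?z\<close>
    descends from \<open>h\<close> to 0 and then from \<open>2 * h\<close> to \<open>h + 1\<close>.
    They satisfy \<open>?x t + ?z t = t + h\<close>, which makes both sums constant.\<close>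
  let ?x = "\<lambda>t. if t \<le> h then 2 * t else 2 * t - 2 * h - 1"
  let ?z = "\<lambda>t. if t \<le> h then h - t else 3 * h + 1 - t"
  let ?w = "\<lambda>t. 6 * n + 1 + ?x t"
  let ?A = "\<lambda>t. 8 * n + 1 + (2 * h - t)"
  let ?B = "\<lambda>t. 1 + ?z t"
  let ?C = "\<lambda>t. 7 * n + 1 + t"
  let ?E = "\<lambda>t. 4 * n + 1 + (2 * h - ?z t)"
  show "{?w t, ?A t, ?B t, ?C t, ?E t} \<subseteq> {1..10 * n}" if "t < n" for t
    using that n by auto
  show "?w t + ?A t + ?B t = 31 * h + 17" if "t < n" for t
    using that n by auto
  show "(10 * n + 1 - ?w t) + ?C t + ?E t = 31 * h + 17" if "t < n" for t
    using that n by auto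
  fix k assume k: "k \<in> {1..10 * n}"
  let ?P = "\<lambda>l. \<exists>t<n. l \<in> {?w t, ?A t, ?B t, ?C t, ?E t}"
  have x: "\<exists>t<n. ?x t = i" if "i < n" for i
  proof (cases "even i")
    case True
    then obtain m where "i = 2 * m" by (elim evenE)
    with that n show ?thesis by (intro exI[of _ m]) auto
  next
    case False
    then obtain m where "i = 2 * m + 1" by (elim oddE)
    with that n show ?thesis by (intro exI[of _ "m + h + 1"]) auto
  qed
  \<comment> \<open>\<open>?z\<close> is an involution, so the witness is
    \<open>?z i\<close>.\<close>
  have z: "\<exists>t<n. ?z t = i" if "i < n" for i
    using that n by (intro exI[of _ "if i \<le> h then h - i else 3 * h + 1 - i"]) auto
  have up: "?P l \<or> ?P (10 * n + 1 - l)" if l: "l \<in> {5 * n + 1..10 * n}" for l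
  proof -
    consider (1) "l \<le> 6 * n" | (2) "6 * n < l" "l \<le> 7 * n" | (3) "7 * n < l" "l \<le> 8 * n"
      | (4) "8 * n < l" "l \<le> 9 * n" | (5) "9 * n < l"
      by linarith
    then show ?thesis
    proof cases
      case 1
      with l have "l - 1 - 5 * n < n" by auto
      from z[OF this] obtain t where "t < n" "?z t = l - 1 - 5 * n" by blast
      moreover from this 1 l n have "10 * n + 1 - l = ?E t" by (auto simp del: One_nat_def)
      ultimately show ?thesis by blast
    next
      case 2
      with l have "l - 1 - 6 * n < n" by auto
      from x[OF this] obtain t where "t < n" "?x t = l - 1 - 6 * n" by blast
      moreover from this 2 l n have "l = ?w t" by (auto simp del: One_nat_def)
      ultimately show ?thesis by blast
    next
      case 3
      with l n show ?thesis by (intro disjI1 exI[of _ "l - 1 - 7 * n"]) auto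
    next
      case 4
      with l n show ?thesis by (intro disjI1 exI[of _ "9 * n - l"]) auto
    next
      case 5
      with l have "10 * n - l < n" by auto
      from z[OF this] obtain t where "t < n" "?z t = 10 * n - l" by blast
      moreover from this 5 l n have "10 * n + 1 - l = ?B t" by auto
      ultimately show ?thesis by blast
    qed
  qed
  have "?P k \<or> ?P (10 * n + 1 - k)"
  proof (cases "k \<le> 5 * n")
    case True
    with k have "10 * n + 1 - k \<in> {5 * n + 1..10 * n}" "10 * n + 1 - (10 * n + 1 - k) = k" by auto
    then show ?thesis using up[of "10 * n + 1 - k"] by metis
  next
    case False
    with k show ?thesis by (intro up) auto
  qed
  then show "\<exists>t<n. k \<in> {?w t, ?A t, ?B t, ?C t, ?E t} \<or> 10 * n + 1 - k \<in> {?w t, ?A t, ?B t, ?C t, ?E t}"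
    by blast
qed

section \<open>Merging and the lower bound\<close>

text \<open>Merged edges correspond one-to-one to the original ones, and the star of a merged vertex
  is the disjoint union of the stars of its members.\<close>

lemma vertex_sum_merge:
  assumes G: "simple_graph G" and M: "simple_graph (merge P G)"
    and inj: "inj_on ((`) (merge_class P)) (edges G)"
  shows "vertex_sum (merge P G) (\<lambda>E. g (inv_into (edges G) ((`) (merge_class P)) E)) X
    = (\<Sum>x \<in> {x \<in> verts G. merge_class P x = X}. vertex_sum G g x)"
proof -
  let ?m = "merge_class P" and ?F = "{x \<in> verts G. merge_class P x = X}"
  have fin: "finite (verts G)" "finite (edges G)"
    using G unfolding simple_graph_def
    by (auto intro!: finite_subset[of "edges G" "Pow (verts G)"])
  \<comment> \<open>An edge and its image both have two elements, so no edge has both ends in one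
    class; this gives disjointness of the stars.\<close>
  have loopfree: "x = y" if "e \<in> edges G" "x \<in> e" "y \<in> e" "?m x = ?m y" for e x y
  proof -
    have "card e = 2" "card (?m ` e) = 2"
      using G M that(1) by (auto simp: simple_graph_def merge_def)
    then have "inj_on ?m e"
      by (metis card.infinite eq_card_imp_inj_on zero_neq_numeral)
    then show ?thesis using that by (auto dest: inj_onD)
  qed
  have "{E \<in> edges (merge P G). X \<in> E} = (`) ?m ` {e \<in> edges G. X \<in> ?m ` e}"
    by (auto simp: merge_def)
  then have "vertex_sum (merge P G) (\<lambda>E. g (inv_into (edges G) ((`) ?m) E)) X
    = (\<Sum>e \<in> {e \<in> edges G. X \<in> ?m ` e}. g e)"
    unfolding vertex_sum_def
    by (simp add: sum.reindex inj_on_subset[OF inj] inv_into_f_f[OF inj])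
  also have "{e \<in> edges G. X \<in> ?m ` e} = (\<Union>x \<in> ?F. {e \<in> edges G. x \<in> e})"
    using G by (auto simp: simple_graph_def)
  also have "sum g \<dots> = (\<Sum>x \<in> ?F. vertex_sum G g x)"
    unfolding vertex_sum_def using fin loopfree by (intro sum.UNION_disjoint) auto
  finally show ?thesis .
qed

lemma merge_class_part:
  assumes "\<And>S T x. S \<in> P \<Longrightarrow> T \<in> P \<Longrightarrow> x \<in> S \<Longrightarrow> x \<in> T \<Longrightarrow> S = T" "S \<in> P" "x \<in> S"
  shows "merge_class P x = S"
  using assms unfolding merge_class_def by blast

text \<open>Disjoint parts make the classes a partition, so the fibre summed over in
  \<open>vertex_sum_merge\<close> is the class itself.\<close>

lemma merge_class_fibre:
  assumes disj: "\<And>S T x. S \<in> P \<Longrightarrow> T \<in> P \<Longrightarrow> x \<in> S \<Longrightarrow> x \<in> T \<Longrightarrow> S = T"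
    and sub: "\<Union> P \<subseteq> verts G" and x: "x \<in> verts G"
  shows "{y \<in> verts G. merge_class P y = merge_class P x} = merge_class P x"
proof -
  have "merge_class P y = S" if "S \<in> P" "y \<in> S" for y S
    by (rule merge_class_part[OF disj that])
  then show ?thesis
    using sub x unfolding merge_class_def by blast
qed

text \<open>A two-valued \<open>vertex_sum\<close> would be a proper 2-colouring. The flip makes its two classes equally
  large, and both classes have the sum of all labels as their total, so the two values would agree.\<close>

lemma card_ge_3_if_flip:
  fixes G :: "'v ugraph"
  assumes G: "simple_graph G" and ne: "edges G \<noteq> {}"
    and inj: "inj_on \<sigma> (verts G)" and maps: "\<sigma> ` verts G \<subseteq> verts G"
    and flip: "\<And>c x. (\<And>u v. {u, v} \<in> edges G \<Longrightarrow> c u \<noteq> c v) \<Longrightarrow> x \<in> verts G \<Longrightarrow> c (\<sigma> x) = (\<not> c x)"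
    and f: "local_antimagic G f"
  shows "3 \<le> card (vertex_sum G f ` verts G)"
proof (rule ccontr)
  let ?s = "vertex_sum G f"
  assume "\<not> ?thesis"
  then have le2: "card (?s ` verts G) \<le> 2" by simp
  have fin: "finite (verts G)" "finite (edges G)"
    using G unfolding simple_graph_def
    by (auto intro!: finite_subset[of "edges G" "Pow (verts G)"])
  have edge: "\<exists>x y. e = {x, y} \<and> x \<noteq> y \<and> x \<in> verts G \<and> y \<in> verts G \<and> ?s x \<noteq> ?s y"
    if "e \<in> edges G" for e
    using that G f unfolding simple_graph_def local_antimagic_def card_2_iff by fastforce
  obtain x0 y0 where xy: "x0 \<in> verts G" "y0 \<in> verts G" "?s x0 \<noteq> ?s y0"
    using ne edge by blast
  have "?s ` verts G = {?s x0, ?s y0}"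
    using xy le2 fin by (intro card_seteq[symmetric]) auto
  then have two: "?s x = ?s x0 \<or> ?s x = ?s y0" if "x \<in> verts G" for x
    using that by blast
  define c where "c = (\<lambda>x. ?s x = ?s x0)"
  define L where "L = {x \<in> verts G. c x}"
  define H where "H = {x \<in> verts G. \<not> c x}"
  have cproper: "c u \<noteq> c v" if "{u, v} \<in> edges G" for u v
  proof -
    have "u \<in> verts G" "v \<in> verts G" "?s u \<noteq> ?s v"
      using that G f by (auto simp: simple_graph_def local_antimagic_def)
    then show ?thesis using two unfolding c_def by metis
  qed
  have cflip: "c (\<sigma> x) = (\<not> c x)" if "x \<in> verts G" for x
    by (rule flip[OF cproper that])
  \<comment> \<open>\<open>\<sigma>\<close> injects each colour class into the other.\<close>
  have "card L \<le> card H" "card H \<le> card L"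
    using fin maps cflip inj unfolding L_def H_def
    by (auto intro!: card_inj_on_le[of \<sigma>] elim!: inj_on_subset)
  then have card: "card L = card H" by simp
  \<comment> \<open>If \<open>K\<close> contains exactly one end of each edge, then summing over
    \<open>K\<close> counts each label once.\<close>
  have total: "(\<Sum>x\<in>K. ?s x) = sum f (edges G)"
    if "K \<subseteq> verts G" "\<And>e. e \<in> edges G \<Longrightarrow> \<exists>!x. x \<in> K \<and> x \<in> e" for K
  proof -
    have "(\<Sum>x\<in>K. ?s x) = sum f (\<Union>x\<in>K. {e \<in> edges G. x \<in> e})"
      unfolding vertex_sum_def using fin that
      by (intro sum.UNION_disjoint[symmetric]) (auto dest: finite_subset)
    also have "(\<Union>x\<in>K. {e \<in> edges G. x \<in> e}) = edges G"
      using that(2) by blast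
    finally show ?thesis .
  qed
  have one: "(\<exists>!x. x \<in> L \<and> x \<in> e) \<and> (\<exists>!x. x \<in> H \<and> x \<in> e)" if e: "e \<in> edges G" for e
  proof -
    obtain x y where "e = {x, y}" "x \<noteq> y" "x \<in> verts G" "y \<in> verts G"
      using edge[OF e] by blast
    moreover from this have "c x \<noteq> c y" using e cproper by blast
    ultimately show ?thesis unfolding L_def H_def by auto
  qed
  have "(\<Sum>x\<in>L. ?s x) = (\<Sum>x\<in>H. ?s x)"
    using one by (subst (1 2) total) (auto simp: L_def H_def)
  moreover have "(\<Sum>x\<in>L. ?s x) = card L * ?s x0"
    by (simp add: L_def c_def)
  moreover have "(\<Sum>x\<in>H. ?s x) = card H * ?s y0"
  proof -
    have "(\<Sum>x\<in>H. ?s x) = (\<Sum>x\<in>H. ?s y0)"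
      using two unfolding H_def c_def by (intro sum.cong) auto
    then show ?thesis by simp
  qed
  moreover have "card L > 0"
    using xy fin by (auto simp: card_gt_0_iff L_def c_def)
  ultimately show False using card xy by simp
qed

section \<open>Proper 2-colourings of the diamond fans\<close>

abbreviation block :: "nat \<Rightarrow> nat \<Rightarrow> df_vertex set set" where
  "block j a \<equiv> {{U 1 j a, W 1 j a}, {W 1 j a, V 1 j a}, {U 2 j a, W 2 j a}, {W 2 j a, V 2 j a},
    {Y j, W 1 j a}, {Y j, U 2 j a}, {Y j, V 2 j a}, {Z j, U 1 j a}, {Z j, V 1 j a}, {Z j, W 2 j a}}"

lemma rDF_edges:
  assumes "j \<in> {1..r}" and "a \<in> {1..s}"
  shows "block j a \<subseteq> edges (rDF r s)"
  unfolding rDF_def ugraph.select_convs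
  by (rule subset_trans[OF _ UN_upper[OF assms(1)]], rule UN_upper[OF assms(2)])

lemma rDF_two_colouring:
  assumes c: "\<And>u v. {u, v} \<in> edges (rDF r s) \<Longrightarrow> c u \<noteq> c v"
    and ja: "j \<in> {1..r}" "a \<in> {1..s}"
  shows "c (U 1 j a) = c (Y j)" "c (V 1 j a) = c (Y j)" "c (W 1 j a) = (\<not> c (Y j))"
    "c (U 2 j a) = (\<not> c (Y j))" "c (V 2 j a) = (\<not> c (Y j))" "c (W 2 j a) = c (Y j)"
    "c (Z j) = (\<not> c (Y j))"
proof -
  note E = rDF_edges[OF ja, unfolded insert_subset]
  \<comment> \<open>These seven edges form a spanning tree on the eight vertices of the block, so
    the colour of \<open>Y j\<close> determines all others.\<close>
  have "c (U 1 j a) \<noteq> c (W 1 j a)" "c (W 1 j a) \<noteq> c (V 1 j a)" "c (U 2 j a) \<noteq> c (W 2 j a)"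
    "c (Y j) \<noteq> c (W 1 j a)" "c (Y j) \<noteq> c (U 2 j a)" "c (Y j) \<noteq> c (V 2 j a)" "c (Z j) \<noteq> c (U 1 j a)"
    by (rule c, simp only: E)+
  then show "c (U 1 j a) = c (Y j)" "c (V 1 j a) = c (Y j)" "c (W 1 j a) = (\<not> c (Y j))"
    "c (U 2 j a) = (\<not> c (Y j))" "c (V 2 j a) = (\<not> c (Y j))" "c (W 2 j a) = c (Y j)"
    "c (Z j) = (\<not> c (Y j))"
    by auto
qed

section \<open>A labeling of the unmerged graph\<close>

text \<open>Adding over both orders makes a function of ordered vertex pairs into a function of the
  edge as a set, so labels can be prescribed by pattern matching on the two ends.\<close>

definition pair_sum :: "('v \<Rightarrow> 'v \<Rightarrow> nat) \<Rightarrow> 'v set \<Rightarrow> nat" where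
  "pair_sum l e = (\<Sum>x\<in>e. \<Sum>y\<in>e. l x y)"

lemma pair_sum_doubleton:
  "x \<noteq> y \<Longrightarrow> pair_sum l {x, y} = l x x + l x y + l y x + l y y"
  by (simp add: pair_sum_def)

text \<open>An edge gets its label from the one orientation on which \<open>arc\<close> does not vanish. In the
  \<open>a\<close>-th part of component \<open>j\<close>, \<open>p 0\<close> is the label of the edge \<open>w\<^sup>1y\<close>, and \<open>p 1, p 2, p 3, p 4\<close>
  are those of the path edges at \<open>u\<^sup>1, v\<^sup>1, u\<^sup>2, v\<^sup>2\<close>; every other edge carries the \<open>M\<close>-complement
  of one of these.\<close>

fun arc :: "nat \<Rightarrow> (nat \<Rightarrow> nat \<Rightarrow> nat \<Rightarrow> nat) \<Rightarrow> df_vertex \<Rightarrow> df_vertex \<Rightarrow> nat" where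
  "arc M p (W i j a) (Y k) = p 0 j a"
| "arc M p (W i j a) (Z k) = M - p 0 j a"
| "arc M p (U i j a) (W i' j' a') = p (if i = 1 then 1 else 3) j a"
| "arc M p (U i j a) (Z k) = M - p 1 j a"
| "arc M p (U i j a) (Y k) = M - p 3 j a"
| "arc M p (V i j a) (W i' j' a') = p (if i = 1 then 2 else 4) j a"
| "arc M p (V i j a) (Z k) = M - p 2 j a"
| "arc M p (V i j a) (Y k) = M - p 4 j a"
| "arc M p x y = 0"

text \<open>The kinds \<open>U\<close>/\<open>V\<close>, \<open>W\<close> and
  \<open>Y\<close>/\<open>Z\<close> form a proper 3-colouring of the diamond fans; this is the
  intended shape of the vertex sums.\<close>

fun by_kind :: "nat \<Rightarrow> nat \<Rightarrow> nat \<Rightarrow> df_vertex \<Rightarrow> nat" where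
  "by_kind \<alpha> \<beta> \<gamma> (U i j a) = \<alpha>"
| "by_kind \<alpha> \<beta> \<gamma> (V i j a) = \<alpha>"
| "by_kind \<alpha> \<beta> \<gamma> (W i j a) = \<beta>"
| "by_kind \<alpha> \<beta> \<gamma> (Y j) = \<gamma>"
| "by_kind \<alpha> \<beta> \<gamma> (Z j) = \<gamma>"

lemma verts_rDF_cases:
  assumes "x \<in> verts (rDF r s)"
  obtains (U) i j a where "x = U i j a" "i \<in> {1, 2}" "j \<in> {1..r}" "a \<in> {1..s}"
    | (V) i j a where "x = V i j a" "i \<in> {1, 2}" "j \<in> {1..r}" "a \<in> {1..s}"
    | (W) i j a where "x = W i j a" "i \<in> {1, 2}" "j \<in> {1..r}" "a \<in> {1..s}"
    | (Y) j where "x = Y j" "j \<in> {1..r}"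
    | (Z) j where "x = Z j" "j \<in> {1..r}"
proof (cases x)
qed (use assms that in \<open>simp_all add: rDF_def, blast+\<close>)

section \<open>Stars of the vertices of the unmerged graph\<close>

lemma members_insert:
  "{e \<in> insert A S. x \<in> e} = (if x \<in> A then insert A {e \<in> S. x \<in> e} else {e \<in> S. x \<in> e})"
  by auto

lemma UN_UN_singleton:
  assumes "j \<in> J" "a \<in> A" and "\<And>j' a'. S j' a' = (if j' = j \<and> a' = a then T else {})"
  shows "(\<Union>j'\<in>J. \<Union>a'\<in>A. S j' a') = T"
  using assms by auto

lemma UN_singleton:
  assumes "j \<in> J" and "\<And>j' a. S j' a = (if j' = j then T a else {})"
  shows "(\<Union>j'\<in>J. \<Union>a\<in>A. S j' a) = (\<Union>a\<in>A. T a)"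
  using assms by auto

lemma rDF_star_eq:
  "{e \<in> edges (rDF r s). x \<in> e} = (\<Union>j\<in>{1..r}. \<Union>a\<in>{1..s}. {e \<in> block j a. x \<in> e})"
  by (simp only: rDF_def ugraph.select_convs UN_simps Collect_conj_eq Collect_mem_eq Int_UN_distrib2)

lemma rDF_star_hub:
  assumes "j \<in> {1..r}"
  shows "{e \<in> edges (rDF r s). Y j \<in> e}
      = (\<Union>a\<in>{1..s}. {{Y j, W 1 j a}, {Y j, U 2 j a}, {Y j, V 2 j a}})"
    "{e \<in> edges (rDF r s). Z j \<in> e}
      = (\<Union>a\<in>{1..s}. {{Z j, U 1 j a}, {Z j, V 1 j a}, {Z j, W 2 j a}})"
  unfolding rDF_star_eq by (rule UN_singleton[OF assms], simp only: members_insert, simp)+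

lemma rDF_star:
  assumes "j \<in> {1..r}" "a \<in> {1..s}"
  shows "{e \<in> edges (rDF r s). U 1 j a \<in> e} = {{U 1 j a, W 1 j a}, {Z j, U 1 j a}}"
    "{e \<in> edges (rDF r s). V 1 j a \<in> e} = {{W 1 j a, V 1 j a}, {Z j, V 1 j a}}"
    "{e \<in> edges (rDF r s). W 1 j a \<in> e} = {{U 1 j a, W 1 j a}, {W 1 j a, V 1 j a}, {Y j, W 1 j a}}"
    "{e \<in> edges (rDF r s). U 2 j a \<in> e} = {{U 2 j a, W 2 j a}, {Y j, U 2 j a}}"
    "{e \<in> edges (rDF r s). V 2 j a \<in> e} = {{W 2 j a, V 2 j a}, {Y j, V 2 j a}}"
    "{e \<in> edges (rDF r s). W 2 j a \<in> e} = {{U 2 j a, W 2 j a}, {W 2 j a, V 2 j a}, {Z j, W 2 j a}}"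
  unfolding rDF_star_eq by (rule UN_UN_singleton[OF assms], simp only: members_insert, simp)+

text \<open>Bijectivity is a counting argument: there are at most \<open>10 * (r * s)\<close> edges
  and every label occurs. The sums at the inner vertices are built into the assumptions, and those
  at the hubs follow from them.\<close>

lemma rDF_labelling:
  fixes r s c :: nat and p :: "nat \<Rightarrow> nat \<Rightarrow> nat \<Rightarrow> nat"
  defines "M \<equiv> 10 * (r * s) + 1"
  assumes range: "\<And>i j a. i < 5 \<Longrightarrow> j \<in> {1..r} \<Longrightarrow> a \<in> {1..s} \<Longrightarrow> p i j a \<in> {1..10 * (r * s)}"
    and c1: "\<And>j a. j \<in> {1..r} \<Longrightarrow> a \<in> {1..s} \<Longrightarrow> p 0 j a + p 1 j a + p 2 j a = c"
    and c2: "\<And>j a. j \<in> {1..r} \<Longrightarrow> a \<in> {1..s} \<Longrightarrow> (M - p 0 j a) + p 3 j a + p 4 j a = c"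
    and cover: "\<And>k. k \<in> {1..10 * (r * s)} \<Longrightarrow>
      \<exists>i<5. \<exists>j\<in>{1..r}. \<exists>a\<in>{1..s}. k = p i j a \<or> M - k = p i j a"
  shows "bij_betw (pair_sum (arc M p)) (edges (rDF r s)) {1..10 * (r * s)}"
    and "x \<in> verts (rDF r s) \<Longrightarrow>
      vertex_sum (rDF r s) (pair_sum (arc M p)) x = by_kind M c (s * (3 * M - c)) x"
proof -
  let ?g = "pair_sum (arc M p)" and ?E = "edges (rDF r s)"
  \<comment> \<open>These bounds keep the truncated subtractions \<open>M - p i j a\<close> exact
    and positive.\<close>
  have le: "p i j a < M" "1 \<le> p i j a" if "i < 5" "j \<in> {1..r}" "a \<in> {1..s}" for i j a
    using range[OF that] unfolding M_def by auto
  have "finite ?E" 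
    by (simp add: rDF_def)
  have "card ?E \<le> (\<Sum>j\<in>{1..r}. \<Sum>a\<in>{1..s}. 10)"
    unfolding rDF_def ugraph.select_convs
    by (intro order_trans[OF card_UN_le] sum_mono) (auto intro!: card_insert_le_m1)
  then have card_le: "card ?E \<le> 10 * (r * s)" by simp
  have block: "?g ` block j a = {p 1 j a, p 2 j a, p 3 j a, p 4 j a, p 0 j a,
      M - p 3 j a, M - p 4 j a, M - p 1 j a, M - p 2 j a, M - p 0 j a}" for j a
    by (simp add: pair_sum_doubleton)
  have E: "?E = (\<Union>j\<in>{1..r}. \<Union>a\<in>{1..s}. block j a)"
    by (simp only: rDF_def ugraph.select_convs)
  have into: "?g ` ?E \<subseteq> {1..10 * (r * s)}"
  proof -
    have "?g ` block j a \<subseteq> {1..10 * (r * s)}" if ja: "j \<in> {1..r}" "a \<in> {1..s}" for j a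
    proof -
      have "p i j a \<in> {1..10 * (r * s)} \<and> M - p i j a \<in> {1..10 * (r * s)}" if "i < 5" for i
        using le[OF that ja] unfolding M_def by auto
      from this[of 0] this[of 1] this[of 2] this[of 3] this[of 4]
      show ?thesis unfolding block by simp
    qed
    then show ?thesis unfolding E image_UN by (intro UN_least) 
  qed
  have onto: "{1..10 * (r * s)} \<subseteq> ?g ` ?E"
  proof
    fix k assume k: "k \<in> {1..10 * (r * s)}"
    then obtain i j a where i: "i < 5" and ja: "j \<in> {1..r}" "a \<in> {1..s}"
      and "k = p i j a \<or> M - k = p i j a"
      using cover by blast
    then have kp: "k = p i j a \<or> k = M - p i j a" using k unfolding M_def by auto
    have "i = 0 \<or> i = 1 \<or> i = 2 \<or> i = 3 \<or> i = 4" using i by linarith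
    then have "k \<in> ?g ` block j a"
      using kp unfolding block by (elim disjE) simp_all
    then show "k \<in> ?g ` ?E" using rDF_edges[OF ja] by blast
  qed
  have img: "?g ` ?E = {1..10 * (r * s)}" using into onto by blast
  then have "card (?g ` ?E) = card ?E"
    using card_le card_image_le[OF \<open>finite ?E\<close>, of ?g] by simp
  then show "bij_betw ?g ?E {1..10 * (r * s)}"
    using img \<open>finite ?E\<close> by (simp add: bij_betw_def eq_card_imp_inj_on)
  \<comment> \<open>The contribution of one block to either hub. At \<open>z\<close> it is
    \<open>3 * M\<close> minus the sum at \<open>w\<^sup>1\<close>; at \<open>y\<close> it is
    \<open>3 * M\<close> minus the sum at \<open>w\<^sup>2\<close>.\<close>
  have hub: "p 0 j a + ((M - p 3 j a) + (M - p 4 j a)) = 3 * M - c"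
    "(M - p 1 j a) + ((M - p 2 j a) + (M - p 0 j a)) = 3 * M - c"
    if ja: "j \<in> {1..r}" "a \<in> {1..s}" for j a
    using c1[OF ja] c2[OF ja] le[OF _ ja, of 0] le[OF _ ja, of 1] le[OF _ ja, of 2]
      le[OF _ ja, of 3] le[OF _ ja, of 4] by auto
  have Y: "vertex_sum (rDF r s) ?g (Y j) = s * (3 * M - c)" if j: "j \<in> {1..r}" for j
  proof -
    have "vertex_sum (rDF r s) ?g (Y j) = (\<Sum>a\<in>{1..s}. \<Sum>e\<in>{{Y j, W 1 j a}, {Y j, U 2 j a}, {Y j, V 2 j a}}. ?g e)"
      unfolding vertex_sum_def rDF_star_hub[OF j]
      by (intro sum.UNION_disjoint) (auto simp: doubleton_eq_iff)
    also have "\<dots> = (\<Sum>a\<in>{1..s}. 3 * M - c)"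
      using hub[OF j] by (intro sum.cong) (simp_all add: pair_sum_doubleton doubleton_eq_iff)
    finally show ?thesis by simp
  qed
  have Z: "vertex_sum (rDF r s) ?g (Z j) = s * (3 * M - c)" if j: "j \<in> {1..r}" for j
  proof -
    have "vertex_sum (rDF r s) ?g (Z j) = (\<Sum>a\<in>{1..s}. \<Sum>e\<in>{{Z j, U 1 j a}, {Z j, V 1 j a}, {Z j, W 2 j a}}. ?g e)"
      unfolding vertex_sum_def rDF_star_hub[OF j]
      by (intro sum.UNION_disjoint) (auto simp: doubleton_eq_iff)
    also have "\<dots> = (\<Sum>a\<in>{1..s}. 3 * M - c)"
      using hub[OF j] by (intro sum.cong) (simp_all add: pair_sum_doubleton doubleton_eq_iff)
    finally show ?thesis by simp
  qed
  have inner: "vertex_sum (rDF r s) ?g (U i j a) = M" "vertex_sum (rDF r s) ?g (V i j a) = M"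
    "vertex_sum (rDF r s) ?g (W i j a) = c"
    if i: "i \<in> {1, 2}" and ja: "j \<in> {1..r}" "a \<in> {1..s}" for i j a
  proof -
    note l = le(1)[OF _ ja, of 1] le(1)[OF _ ja, of 2] le(1)[OF _ ja, of 3] le(1)[OF _ ja, of 4]
    consider (1) "i = 1" | (2) "i = 2" using i by blast
    then have "vertex_sum (rDF r s) ?g (U i j a) = M \<and> vertex_sum (rDF r s) ?g (V i j a) = M
      \<and> vertex_sum (rDF r s) ?g (W i j a) = c"
    proof cases
      case 1
      show ?thesis
        unfolding 1 vertex_sum_def rDF_star[OF ja] using c1[OF ja] l
        by (simp add: pair_sum_doubleton doubleton_eq_iff)
    next
      case 2
      show ?thesis
        unfolding 2 vertex_sum_def rDF_star[OF ja] using c2[OF ja] l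
        by (simp add: pair_sum_doubleton doubleton_eq_iff)
    qed
    then show "vertex_sum (rDF r s) ?g (U i j a) = M" "vertex_sum (rDF r s) ?g (V i j a) = M"
      "vertex_sum (rDF r s) ?g (W i j a) = c" by blast+
  qed
  show "vertex_sum (rDF r s) ?g x = by_kind M c (s * (3 * M - c)) x" if x: "x \<in> verts (rDF r s)"
    using x by (cases rule: verts_rDF_cases) (simp_all only: by_kind.simps inner Y Z)
qed

section \<open>The local antimagic chromatic number after merging\<close>

lemma rDF_edge_kinds:
  assumes "e \<in> edges (rDF r s)" and "distinct [\<alpha>, \<beta>, \<gamma>]"
  shows "\<exists>x y. e = {x, y} \<and> x \<in> verts (rDF r s) \<and> y \<in> verts (rDF r s)
    \<and> by_kind \<alpha> \<beta> \<gamma> x \<noteq> by_kind \<alpha> \<beta> \<gamma> y"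
proof -
  obtain x y where xy: "e = {x, y}" "x \<in> verts (rDF r s)" "y \<in> verts (rDF r s)"
    using assms(1) simple_graph_rDF[of r s] unfolding simple_graph_def card_2_iff by fastforce
  obtain j a where "e \<in> block j a"
    using assms(1) unfolding rDF_def ugraph.select_convs by (elim UN_E)
  then have "by_kind \<alpha> \<beta> \<gamma> x \<noteq> by_kind \<alpha> \<beta> \<gamma> y"
    using assms(2) unfolding xy insert_iff empty_iff doubleton_eq_iff
    by (elim disjE conjE) simp_all
  with xy show ?thesis by blast
qed

text \<open>Upper bound: \<open>g\<close> is carried over along the bijection between the edge sets,
  and the three kinds give its three values. Lower bound: \<open>\<sigma>\<close> permutes vertices
  compatibly with merging, hence acts on the classes, and there it supplies the flip for
  \<open>card_ge_3_if_flip\<close>.\<close>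

lemma chi_la_merge_rDF:
  fixes r s :: nat and P :: "df_vertex set set"
  defines "G \<equiv> merge P (rDF r s)"
  assumes rs: "r \<ge> 1" "s \<ge> 1"
    and disj: "\<And>S T x. S \<in> P \<Longrightarrow> T \<in> P \<Longrightarrow> x \<in> S \<Longrightarrow> x \<in> T \<Longrightarrow> S = T"
    and sub: "\<Union> P \<subseteq> verts (rDF r s)"
    and inj: "inj_on ((`) (merge_class P)) (edges (rDF r s))"
    and simple: "simple_graph G"
    and g: "bij_betw g (edges (rDF r s)) {1..10 * (r * s)}"
    and sums: "\<And>x. x \<in> verts (rDF r s) \<Longrightarrow> 
        (\<Sum>y\<in>merge_class P x. vertex_sum (rDF r s) g y) = by_kind \<alpha> \<beta> \<gamma> x"
    and dist: "distinct [\<alpha>, \<beta>, \<gamma>]"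
    and \<sigma>: "inj_on \<sigma> (verts (rDF r s))" "\<And>x. x \<in> verts (rDF r s) \<Longrightarrow> \<sigma> x \<in> verts (rDF r s)"
      "\<And>x. x \<in> verts (rDF r s) \<Longrightarrow> merge_class P (\<sigma> x) = \<sigma> ` merge_class P x"
    and flip: "\<And>c x. (\<And>u v. {u, v} \<in> edges (rDF r s) \<Longrightarrow> c u \<noteq> c v) \<Longrightarrow>
        (\<And>S u v. S \<in> P \<Longrightarrow> u \<in> S \<Longrightarrow> v \<in> S \<Longrightarrow> c u = c v) \<Longrightarrow>
        x \<in> verts (rDF r s) \<Longrightarrow> c (\<sigma> x) = (\<not> c x)"
  shows "chi_la G = 3"
proof -
  let ?m = "merge_class P" and ?H = "rDF r s"
  define f where "f = (\<lambda>E. g (inv_into (edges ?H) ((`) ?m) E))"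
  have vsum: "vertex_sum G f (?m x) = by_kind \<alpha> \<beta> \<gamma> x" if "x \<in> verts ?H" for x
    using vertex_sum_merge[OF simple_graph_rDF simple[unfolded G_def] inj, of g "?m x"]
      merge_class_fibre[OF disj sub that] sums[OF that]
    unfolding f_def G_def by simp
  have verts: "verts G = ?m ` verts ?H" and edges: "edges G = (`) ?m ` edges ?H"
    by (simp_all add: G_def merge_def)
  have "card (edges G) = 10 * (r * s)"
    using bij_betw_same_card[OF g] card_image[OF inj] unfolding edges by simp
  moreover have "bij_betw f (edges G) {1..10 * (r * s)}"
  proof -
    have "bij_betw (inv_into (edges ?H) ((`) ?m)) (edges G) (edges ?H)"
      unfolding edges by (intro bij_betw_inv_into) (simp add: bij_betw_def inj)
    from bij_betw_trans[OF this g] show ?thesis by (simp add: f_def comp_def)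
  qed
  moreover have "vertex_sum G f u \<noteq> vertex_sum G f v" if uv: "{u, v} \<in> edges G" for u v
  proof -
    obtain e where "e \<in> edges ?H" "{u, v} = ?m ` e"
      using uv unfolding edges by blast
    moreover from this(1) obtain x y where "e = {x, y}" "x \<in> verts ?H" "y \<in> verts ?H"
      "by_kind \<alpha> \<beta> \<gamma> x \<noteq> by_kind \<alpha> \<beta> \<gamma> y"
      using rDF_edge_kinds[OF _ dist] by blast
    ultimately show ?thesis
      using vsum by (auto simp: doubleton_eq_iff)
  qed
  ultimately have lam: "local_antimagic G f"
    by (simp add: local_antimagic_def)
  have lower: "3 \<le> card (vertex_sum G f' ` verts G)" if "local_antimagic G f'" for f'
  proof (rule card_ge_3_if_flip[OF simple _ _ _ _ that, of "(`) \<sigma>"])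
    have "block 1 1 \<subseteq> edges ?H" using rs by (intro rDF_edges) auto
    then show "edges G \<noteq> {}" unfolding edges by blast
    have msub: "?m x \<subseteq> verts ?H" if "x \<in> verts ?H" for x
      using that sub by (auto simp: merge_class_def)
    show "inj_on ((`) \<sigma>) (verts G)"
      unfolding verts
      \<comment> \<open>Merged vertices are sets of original vertices, and taking images under an
        injective map is injective on such sets.\<close>
      by (rule inj_on_subset[OF inj_on_image_Pow[OF \<sigma>(1)]]) (use msub in auto)
    show "(`) \<sigma> ` verts G \<subseteq> verts G"
      using \<sigma>(2,3) unfolding verts by (auto simp flip: \<sigma>(3))
    fix c :: "df_vertex set \<Rightarrow> bool" and X assume c: "\<And>u v. {u, v} \<in> edges G \<Longrightarrow> c u \<noteq> c v" and "X \<in> verts G"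
    then obtain x where x: "x \<in> verts ?H" "X = ?m x" unfolding verts by blast
    have "c (?m (\<sigma> x)) = (\<not> c (?m x))"
    \<comment> \<open>A 2-colouring of the merged graph pulls back to one of the original graph that
      is constant on every merged set.\<close>
    proof (rule flip[of "\<lambda>x. c (?m x)"])
      show "c (?m u) \<noteq> c (?m v)" if "{u, v} \<in> edges ?H" for u v
        using that by (intro c) (auto simp: edges intro!: image_eqI[of _ _ "{u, v}"])
      show "c (?m u) = c (?m v)" if "S \<in> P" "u \<in> S" "v \<in> S" for S u v
        using merge_class_part[OF disj that(1,2)] merge_class_part[OF disj that(1,3)] by simp
    qed fact
    then show "c (\<sigma> ` X) = (\<not> c X)" using \<sigma>(3) x by simp
  qed
  have "by_kind \<alpha> \<beta> \<gamma> x \<in> {\<alpha>, \<beta>, \<gamma>}" for x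
    by (cases x) simp_all
  then have "vertex_sum G f ` verts G \<subseteq> {\<alpha>, \<beta>, \<gamma>}"
    unfolding verts image_image by (intro image_subsetI) (simp only: vsum)
  then have "card (vertex_sum G f ` verts G) \<le> card {\<alpha>, \<beta>, \<gamma>}"
    by (intro card_mono) auto
  then have "card (vertex_sum G f ` verts G) \<le> 3"
    using card_length[of "[\<alpha>, \<beta>, \<gamma>]"] by simp
  with lower[OF lam] have "card (vertex_sum G f ` verts G) = 3" by simp
  then show ?thesis
    \<comment> \<open>The value 3 is attained by \<open>f\<close> and is a lower bound, so the
      infimum is a genuine minimum and not the default 0 of the empty set.\<close>
    unfolding chi_la_def using lam lower by (intro cInf_eq_minimum) auto
qed

text \<open>One quintuple is assigned to each block. Doubling \<open>c\<close> avoids a division: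
  \<open>c\<close> is \<open>15 * n + 1\<close> for even \<open>n\<close>, but half of
  \<open>31 * n + 3\<close> for odd \<open>n\<close>.\<close>

lemma rDF_labelling_exists:
  fixes r s :: nat
  assumes "r \<ge> 1" "s \<ge> 1"
  obtains g c where "bij_betw g (edges (rDF r s)) {1..10 * (r * s)}"
    "\<And>x. x \<in> verts (rDF r s) \<Longrightarrow> vertex_sum (rDF r s) g x
       = by_kind (10 * (r * s) + 1) c (s * (3 * (10 * (r * s) + 1) - c)) x"
    "2 * c = (if even (r * s) then 30 * (r * s) + 2 else 31 * (r * s) + 3)"
proof -
  define n where "n = r * s"
  obtain w A B C E :: "nat \<Rightarrow> nat" and c where
    range: "\<And>t. t < n \<Longrightarrow> {w t, A t, B t, C t, E t} \<subseteq> {1..10 * n}"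
    and sums: "\<And>t. t < n \<Longrightarrow> w t + A t + B t = c"
      "\<And>t. t < n \<Longrightarrow> (10 * n + 1 - w t) + C t + E t = c"
    and cover: "\<And>k. k \<in> {1..10 * n} \<Longrightarrow> \<exists>t<n. k \<in> {w t, A t, B t, C t, E t}
       \<or> 10 * n + 1 - k \<in> {w t, A t, B t, C t, E t}"
    and c: "2 * c = (if even n then 30 * n + 2 else 31 * n + 3)"
  proof (cases "even n")
    case True
    then obtain q where q: "n = 2 * q" by (elim evenE)
    obtain w A B C E :: "nat \<Rightarrow> nat" where
      "\<And>t. t < 2 * q \<Longrightarrow> {w t, A t, B t, C t, E t} \<subseteq> {1..20 * q}"
      "\<And>t. t < 2 * q \<Longrightarrow> w t + A t + B t = 30 * q + 1"
      "\<And>t. t < 2 * q \<Longrightarrow> (20 * q + 1 - w t) + C t + E t = 30 * q + 1"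
      "\<And>k. k \<in> {1..20 * q} \<Longrightarrow>
         \<exists>t<2 * q. k \<in> {w t, A t, B t, C t, E t} \<or> 20 * q + 1 - k \<in> {w t, A t, B t, C t, E t}"
      using labels_even[of q] by blast
    with q show ?thesis by (intro that[of w A B C E "30 * q + 1"]) simp_all
  next
    case False
    then obtain h where h: "n = 2 * h + 1" by (elim oddE)
    obtain w A B C E :: "nat \<Rightarrow> nat" where
      "\<And>t. t < n \<Longrightarrow> {w t, A t, B t, C t, E t} \<subseteq> {1..10 * n}"
      "\<And>t. t < n \<Longrightarrow> w t + A t + B t = 31 * h + 17"
      "\<And>t. t < n \<Longrightarrow> (10 * n + 1 - w t) + C t + E t = 31 * h + 17"
      "\<And>k. k \<in> {1..10 * n} \<Longrightarrow>
         \<exists>t<n. k \<in> {w t, A t, B t, C t, E t} \<or> 10 * n + 1 - k \<in> {w t, A t, B t, C t, E t}"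
      using labels_odd[OF h] by blast
    moreover have "2 * (31 * h + 17) = (if even n then 30 * n + 2 else 31 * n + 3)"
      using h by simp
    ultimately show ?thesis by (rule that)
  qed
  \<comment> \<open>Row by row enumeration of the pairs \<open>(j, a)\<close>; the index
    \<open>t\<close> starts at 0, while \<open>j\<close> and \<open>a\<close> start at 1.\<close>
  define t where "t = (\<lambda>j a. (j - 1) * s + (a - 1))"
  have t_less: "t j a < n" if "j \<in> {1..r}" "a \<in> {1..s}" for j a
  proof -
    have "t j a < (j - 1) * s + s" using that by (auto simp: t_def)
    also have "\<dots> = j * s" using that by (cases j) auto
    also have "\<dots> \<le> n" using that by (simp add: n_def)
    finally show ?thesis .
  qed
  have t_onto: "\<exists>j\<in>{1..r}. \<exists>a\<in>{1..s}. t j a = k" if "k < n" for k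
  proof (intro bexI)
    show "t (k div s + 1) (k mod s + 1) = k" by (simp add: t_def)
    show "k div s + 1 \<in> {1..r}" using that assms
      by (simp add: n_def Suc_le_eq less_mult_imp_div_less)
    show "k mod s + 1 \<in> {1..s}" using assms by (simp add: Suc_le_eq)
  qed
  define p where "p = (\<lambda>(i :: nat) j a. (if i = 0 then w else if i = 1 then A else if i = 2 then B
    else if i = 3 then C else E) (t j a))"
  have p: "p 0 j a = w (t j a)" "p 1 j a = A (t j a)" "p 2 j a = B (t j a)"
    "p 3 j a = C (t j a)" "p 4 j a = E (t j a)" for j a
    by (simp_all add: p_def)
  have range': "p i j a \<in> {1..10 * n}" if "j \<in> {1..r}" "a \<in> {1..s}" for i j a
    using range[OF t_less[OF that]] by (simp add: p_def)
  have cover': "\<exists>i<5. \<exists>j\<in>{1..r}. \<exists>a\<in>{1..s}. k = p i j a \<or> 10 * n + 1 - k = p i j a"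
    if k: "k \<in> {1..10 * n}" for k
  proof -
    obtain u where u: "u < n" "k \<in> {w u, A u, B u, C u, E u} \<or> 10 * n + 1 - k \<in> {w u, A u, B u, C u, E u}"
      using cover[OF k] by blast
    obtain j a where ja: "j \<in> {1..r}" "a \<in> {1..s}" "t j a = u" using t_onto[OF u(1)] by blast
    have "\<exists>i<5. l = p i j a" if l: "l \<in> {w u, A u, B u, C u, E u}" for l
    proof -
      have "\<exists>i\<in>{0, 1, 2, 3, 4}. l = p i j a" using l by (simp add: p ja del: One_nat_def)
      then show ?thesis by force
    qed
    then show ?thesis using u(2) ja by blast
  qed
  note lab = rDF_labelling[of r s p c, folded n_def, OF range' _ _ cover']
  show ?thesis
  proof (rule that)
    show "bij_betw (pair_sum (arc (10 * (r * s) + 1) p)) (edges (rDF r s)) {1..10 * (r * s)}"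
      unfolding n_def[symmetric] using sums t_less by (intro lab(1)) (simp_all add: p del: One_nat_def)
    show "vertex_sum (rDF r s) (pair_sum (arc (10 * (r * s) + 1) p)) x
       = by_kind (10 * (r * s) + 1) c (s * (3 * (10 * (r * s) + 1) - c)) x"
      if "x \<in> verts (rDF r s)" for x
      unfolding n_def[symmetric] using sums t_less that by (intro lab(2)) (simp_all add: p del: One_nat_def)
    show "2 * c = (if even (r * s) then 30 * (r * s) + 2 else 31 * (r * s) + 3)"
      using c by (simp add: n_def)
  qed
qed

section \<open>Symmetries and merging classes of diamond fans\<close>

fun swap :: "df_vertex \<Rightarrow> df_vertex" where
  "swap (U i j a) = U (if i = 1 then 2 else 1) j a"
| "swap (V i j a) = V (if i = 1 then 2 else 1) j a"
| "swap (W i j a) = W (if i = 1 then 2 else 1) j a"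
| "swap (Y j) = Z j"
| "swap (Z j) = Y j"

lemma verts_rDF_iff:
  "U i j a \<in> verts (rDF r s) \<longleftrightarrow> i \<in> {1, 2} \<and> j \<in> {1..r} \<and> a \<in> {1..s}"
  "V i j a \<in> verts (rDF r s) \<longleftrightarrow> i \<in> {1, 2} \<and> j \<in> {1..r} \<and> a \<in> {1..s}"
  "W i j a \<in> verts (rDF r s) \<longleftrightarrow> i \<in> {1, 2} \<and> j \<in> {1..r} \<and> a \<in> {1..s}"
  "Y j \<in> verts (rDF r s) \<longleftrightarrow> j \<in> {1..r}"
  "Z j \<in> verts (rDF r s) \<longleftrightarrow> j \<in> {1..r}"
  by (auto simp: rDF_def)

lemma swap_verts: "x \<in> verts (rDF r s) \<Longrightarrow> swap x \<in> verts (rDF r s)"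
  by (cases x) (simp_all add: verts_rDF_iff)

text \<open>\<open>swap\<close> is an involution where the superscripts are 1 or 2; every other
  superscript is sent to 1, hence the restriction to the vertex set.\<close>

lemma swap_inj: "inj_on swap (verts (rDF r s))"
proof (rule inj_on_inverseI)
  show "swap (swap x) = x" if "x \<in> verts (rDF r s)" for x
    using that by (cases x) (auto simp: verts_rDF_iff)
qed

lemma swap_flip:
  assumes c: "\<And>u v. {u, v} \<in> edges (rDF r s) \<Longrightarrow> c u \<noteq> c v"
    and "s \<ge> 1" "x \<in> verts (rDF r s)"
  shows "c (swap x) = (\<not> c x)"
proof -
  note col = rDF_two_colouring[of r s c, OF c]
  have "1 \<in> {1..s}" using assms(2) by simp
  with assms(3) show ?thesis
    \<comment> \<open>The colours of \<open>Y j\<close> and \<open>Z j\<close> are compared through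
      the block with \<open>a = 1\<close>; every other vertex has a block of its own.\<close>
    by (cases rule: verts_rDF_cases) (auto simp: col col(7)[of _ 1] simp del: One_nat_def)
qed

definition cyc :: "nat \<Rightarrow> nat \<Rightarrow> nat" where
  "cyc r j = (if j = r then 1 else j + 1)"

text \<open>The rotation carries each set \<open>{Y j, Z (cyc r j)}\<close> to the next one, whereas
  \<open>swap\<close> in general does not map these sets to each other.\<close>

fun shift :: "nat \<Rightarrow> df_vertex \<Rightarrow> df_vertex" where
  "shift r (U i j a) = U i (cyc r j) a"
| "shift r (V i j a) = V i (cyc r j) a"
| "shift r (W i j a) = W i (cyc r j) a"
| "shift r (Y j) = Y (cyc r j)"
| "shift r (Z j) = Z (cyc r j)"

lemma cyc_in: "j \<in> {1..r} \<Longrightarrow> cyc r j \<in> {1..r}"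
  by (auto simp: cyc_def)

lemma cyc_inj: "j \<in> {1..r} \<Longrightarrow> k \<in> {1..r} \<Longrightarrow> cyc r j = cyc r k \<longleftrightarrow> j = k"
  by (auto simp: cyc_def)

lemma cyc_onto: "k \<in> {1..r} \<Longrightarrow> \<exists>j\<in>{1..r}. k = cyc r j"
  by (rule bexI[of _ "if k = 1 then r else k - 1"]) (auto simp: cyc_def)

lemma shift_verts: "x \<in> verts (rDF r s) \<Longrightarrow> shift r x \<in> verts (rDF r s)"
  by (cases x) (simp_all add: verts_rDF_iff cyc_in del: atLeastAtMost_iff One_nat_def)

lemma shift_inj: "inj_on (shift r) (verts (rDF r s))"
proof (rule inj_onI)
  fix x y assume "x \<in> verts (rDF r s)" "y \<in> verts (rDF r s)" "shift r x = shift r y"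
  then show "x = y"
    by (elim verts_rDF_cases) (simp_all add: cyc_inj)
qed

lemma parts4_cyc: "parts4 r = (\<lambda>j. {Y j, Z (cyc r j)}) ` {1..r}"
  unfolding parts4_def cyc_def by (rule Setcompr_eq_image)

text \<open>Merging gives \<open>Y j\<close> the colour of \<open>Z (cyc r j)\<close>, which is
  opposite to that of \<open>Y (cyc r j)\<close>. So consecutive components are coloured
  oppositely.\<close>

lemma shift_flip:
  assumes c: "\<And>u v. {u, v} \<in> edges (rDF r s) \<Longrightarrow> c u \<noteq> c v"
    and m: "\<And>S u v. S \<in> parts4 r \<Longrightarrow> u \<in> S \<Longrightarrow> v \<in> S \<Longrightarrow> c u = c v"
    and "s \<ge> 1" "x \<in> verts (rDF r s)"
  shows "c (shift r x) = (\<not> c x)"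
proof -
  note col = rDF_two_colouring[of r s c, OF c]
  have s: "1 \<in> {1..s}" using assms(3) by simp
  have Z: "c (Z j) = (\<not> c (Y j))" if "j \<in> {1..r}" for j
    using col(7)[OF _ that s] .
  have Y: "c (Y (cyc r j)) = (\<not> c (Y j))" if "j \<in> {1..r}" for j
    using m[of "{Y j, Z (cyc r j)}" "Y j" "Z (cyc r j)"] that Z[OF cyc_in[OF that]]
    by (auto simp: parts4_cyc)
  show ?thesis
    using assms(4) by (cases rule: verts_rDF_cases) (auto simp: col Z Y cyc_in simp del: One_nat_def atLeastAtMost_iff)
qed

section \<open>Merged sets and their classes\<close>

lemma parts_members:
  "S \<in> parts1 r s \<Longrightarrow> x \<in> S \<Longrightarrow>
    \<exists>i\<in>{1, 2}. \<exists>j\<in>{1..r}. \<exists>a\<in>{1..s}. x = W i j a \<and> S = {W i k a | k. k \<in> {1..r}}"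
  "S \<in> parts2 r s \<Longrightarrow> x \<in> S \<Longrightarrow> \<exists>i\<in>{1, 2}. \<exists>j\<in>{1..r}. \<exists>a\<in>{1..s}.
    x = U i j a \<and> S = {U i k a | k. k \<in> {1..r}} \<or> x = V i j a \<and> S = {V i k a | k. k \<in> {1..r}}"
  "S \<in> parts3 r \<Longrightarrow> x \<in> S \<Longrightarrow>
    \<exists>j\<in>{1..r}. x = Y j \<and> S = {Y k | k. k \<in> {1..r}} \<or> x = Z j \<and> S = {Z k | k. k \<in> {1..r}}"
  "S \<in> parts4 r \<Longrightarrow> x \<in> S \<Longrightarrow>
    \<exists>j\<in>{1..r}. (x = Y j \<or> x = Z (cyc r j)) \<and> S = {Y j, Z (cyc r j)}"
proof -
  assume S: "S \<in> parts1 r s" and x: "x \<in> S"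
  obtain i a where ia: "i \<in> {1, 2}" "a \<in> {1..s}" and S: "S = {W i k a | k. k \<in> {1..r}}"
    using S unfolding parts1_def by (elim UN_E insertE emptyE) auto
  from x S obtain j where "j \<in> {1..r}" "x = W i j a" by blast
  with ia S show "\<exists>i\<in>{1, 2}. \<exists>j\<in>{1..r}. \<exists>a\<in>{1..s}. x = W i j a \<and> S = {W i k a | k. k \<in> {1..r}}"
    by blast
next
  assume S: "S \<in> parts2 r s" and x: "x \<in> S"
  \<comment> \<open>\<open>C\<close> ranges over the constructors \<open>U\<close> and
    \<open>V\<close>, so that one argument serves both.\<close>
  obtain C i a where ia: "i \<in> {1, 2}" "a \<in> {1..s}" and C: "C = U \<or> C = V"
    and S: "S = {C i k a | k. k \<in> {1..r}}"
  proof -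
    from S obtain a where "a \<in> {1..s}" "S \<in> {{U 1 j a | j. j \<in> {1..r}}, {U 2 j a | j. j \<in> {1..r}},
        {V 1 j a | j. j \<in> {1..r}}, {V 2 j a | j. j \<in> {1..r}}}"
      unfolding parts2_def by (elim UN_E)
    then show ?thesis
      using that[of 1 a U] that[of 2 a U] that[of 1 a V] that[of 2 a V]
      by (elim insertE emptyE) simp_all
  qed
  from x S obtain j where "j \<in> {1..r}" "x = C i j a" by blast
  with ia C S show "\<exists>i\<in>{1, 2}. \<exists>j\<in>{1..r}. \<exists>a\<in>{1..s}.
      x = U i j a \<and> S = {U i k a | k. k \<in> {1..r}} \<or> x = V i j a \<and> S = {V i k a | k. k \<in> {1..r}}"
    by blast
next
  assume S: "S \<in> parts3 r" and x: "x \<in> S"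
  obtain C where C: "C = Y \<or> C = Z" and S: "S = {C k | k. k \<in> {1..r}}"
    using S unfolding parts3_def by (elim insertE emptyE) auto
  from x S obtain j where "j \<in> {1..r}" "x = C j" by blast
  with C S show "\<exists>j\<in>{1..r}.
      x = Y j \<and> S = {Y k | k. k \<in> {1..r}} \<or> x = Z j \<and> S = {Z k | k. k \<in> {1..r}}"
    by blast
next
  assume "S \<in> parts4 r" and "x \<in> S"
  then show "\<exists>j\<in>{1..r}. (x = Y j \<or> x = Z (cyc r j)) \<and> S = {Y j, Z (cyc r j)}"
    unfolding parts4_cyc by blast
qed

text \<open>A vertex determines the part containing it: its constructor and indices can be read off,
  and in \<open>parts4\<close> a vertex \<open>Z k\<close> determines \<open>j\<close> because
  \<open>cyc\<close> is injective.\<close>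

lemma parts_disjoint:
  "S \<in> parts1 r s \<Longrightarrow> T \<in> parts1 r s \<Longrightarrow> x \<in> S \<Longrightarrow> x \<in> T \<Longrightarrow> S = T"
  "S \<in> parts2 r s \<Longrightarrow> T \<in> parts2 r s \<Longrightarrow> x \<in> S \<Longrightarrow> x \<in> T \<Longrightarrow> S = T"
  "S \<in> parts3 r \<Longrightarrow> T \<in> parts3 r \<Longrightarrow> x \<in> S \<Longrightarrow> x \<in> T \<Longrightarrow> S = T"
  "S \<in> parts4 r \<Longrightarrow> T \<in> parts4 r \<Longrightarrow> x \<in> S \<Longrightarrow> x \<in> T \<Longrightarrow> S = T"
proof -
  show "S = T" if "S \<in> parts1 r s" "T \<in> parts1 r s" "x \<in> S" "x \<in> T"
    using parts_members(1)[OF that(1,3)] parts_members(1)[OF that(2,4)] by (elim bexE conjE) simp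
  show "S = T" if "S \<in> parts2 r s" "T \<in> parts2 r s" "x \<in> S" "x \<in> T"
    using parts_members(2)[OF that(1,3)] parts_members(2)[OF that(2,4)]
    by (elim bexE disjE conjE) simp_all
  show "S = T" if "S \<in> parts3 r" "T \<in> parts3 r" "x \<in> S" "x \<in> T"
    using parts_members(3)[OF that(1,3)] parts_members(3)[OF that(2,4)]
    by (elim bexE disjE conjE) simp_all
  show "S = T" if "S \<in> parts4 r" "T \<in> parts4 r" "x \<in> S" "x \<in> T"
    using parts_members(4)[OF that(1,3)] parts_members(4)[OF that(2,4)]
    by (elim bexE disjE conjE) (simp_all add: cyc_inj del: atLeastAtMost_iff)
qed

lemma parts_verts:
  "\<Union> (parts1 r s) \<subseteq> verts (rDF r s)" "\<Union> (parts2 r s) \<subseteq> verts (rDF r s)"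
  "\<Union> (parts3 r) \<subseteq> verts (rDF r s)" "\<Union> (parts4 r) \<subseteq> verts (rDF r s)"
proof -
  show "\<Union> (parts1 r s) \<subseteq> verts (rDF r s)"
    by (auto dest!: parts_members(1) simp: verts_rDF_iff)
  show "\<Union> (parts2 r s) \<subseteq> verts (rDF r s)"
    by (auto dest!: parts_members(2) simp: verts_rDF_iff)
  show "\<Union> (parts3 r) \<subseteq> verts (rDF r s)"
    by (auto dest!: parts_members(3) simp: verts_rDF_iff)
  show "\<Union> (parts4 r) \<subseteq> verts (rDF r s)"
    by (auto dest!: parts_members(4) simp: verts_rDF_iff cyc_in simp del: atLeastAtMost_iff One_nat_def)
qed

lemma merge_class_parts1:
  shows "i \<in> {1, 2} \<Longrightarrow> j \<in> {1..r} \<Longrightarrow> a \<in> {1..s} \<Longrightarrow> merge_class (parts1 r s) (W i j a) = (\<lambda>k. W i k a) ` {1..r}"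
    "merge_class (parts1 r s) (U i j a) = {U i j a}"
    "merge_class (parts1 r s) (V i j a) = {V i j a}"
    "merge_class (parts1 r s) (Y j) = {Y j}"
    "merge_class (parts1 r s) (Z j) = {Z j}"
proof -
  show "merge_class (parts1 r s) (W i j a) = (\<lambda>k. W i k a) ` {1..r}"
    if "i \<in> {1, 2}" "j \<in> {1..r}" "a \<in> {1..s}"
    by (rule merge_class_part[OF parts_disjoint(1)]) (use that in \<open>auto simp: parts1_def\<close>)
  show "merge_class (parts1 r s) (U i j a) = {U i j a}"
    "merge_class (parts1 r s) (V i j a) = {V i j a}"
    "merge_class (parts1 r s) (Y j) = {Y j}"
    "merge_class (parts1 r s) (Z j) = {Z j}"
    by (auto simp: merge_class_def parts1_def)
qed

lemma merge_class_parts2: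
  shows "i \<in> {1, 2} \<Longrightarrow> j \<in> {1..r} \<Longrightarrow> a \<in> {1..s} \<Longrightarrow> merge_class (parts2 r s) (U i j a) = (\<lambda>k. U i k a) ` {1..r}"
    "i \<in> {1, 2} \<Longrightarrow> j \<in> {1..r} \<Longrightarrow> a \<in> {1..s} \<Longrightarrow> merge_class (parts2 r s) (V i j a) = (\<lambda>k. V i k a) ` {1..r}"
    "merge_class (parts2 r s) (W i j a) = {W i j a}"
    "merge_class (parts2 r s) (Y j) = {Y j}"
    "merge_class (parts2 r s) (Z j) = {Z j}"
proof -
  show "merge_class (parts2 r s) (U i j a) = (\<lambda>k. U i k a) ` {1..r}"
    if "i \<in> {1, 2}" "j \<in> {1..r}" "a \<in> {1..s}"
    by (rule merge_class_part[OF parts_disjoint(2)]) (use that in \<open>auto simp: parts2_def\<close>)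
  show "merge_class (parts2 r s) (V i j a) = (\<lambda>k. V i k a) ` {1..r}"
    if "i \<in> {1, 2}" "j \<in> {1..r}" "a \<in> {1..s}"
    by (rule merge_class_part[OF parts_disjoint(2)]) (use that in \<open>auto simp: parts2_def\<close>)
  show "merge_class (parts2 r s) (W i j a) = {W i j a}"
    "merge_class (parts2 r s) (Y j) = {Y j}"
    "merge_class (parts2 r s) (Z j) = {Z j}"
    by (auto simp: merge_class_def parts2_def)
qed

lemma merge_class_parts3:
  shows "j \<in> {1..r} \<Longrightarrow> merge_class (parts3 r) (Y j) = Y ` {1..r}"
    "j \<in> {1..r} \<Longrightarrow> merge_class (parts3 r) (Z j) = Z ` {1..r}"
    "merge_class (parts3 r) (U i j a) = {U i j a}"
    "merge_class (parts3 r) (V i j a) = {V i j a}"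
    "merge_class (parts3 r) (W i j a) = {W i j a}"
proof -
  show "merge_class (parts3 r) (Y j) = Y ` {1..r}"
    if "j \<in> {1..r}"
    by (rule merge_class_part[OF parts_disjoint(3)]) (use that in \<open>auto simp: parts3_def\<close>)
  show "merge_class (parts3 r) (Z j) = Z ` {1..r}"
    if "j \<in> {1..r}"
    by (rule merge_class_part[OF parts_disjoint(3)]) (use that in \<open>auto simp: parts3_def\<close>)
  show "merge_class (parts3 r) (U i j a) = {U i j a}"
    "merge_class (parts3 r) (V i j a) = {V i j a}"
    "merge_class (parts3 r) (W i j a) = {W i j a}"
    by (auto simp: merge_class_def parts3_def)
qed

text \<open>The classes of the \<open>Z\<close> vertices are indexed by the predecessor; by
  \<open>cyc_onto\<close> every \<open>Z k\<close> in the graph has the form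
  \<open>Z (cyc r j)\<close>.\<close>

lemma merge_class_parts4:
  shows "j \<in> {1..r} \<Longrightarrow> merge_class (parts4 r) (Y j) = {Y j, Z (cyc r j)}"
    "j \<in> {1..r} \<Longrightarrow> merge_class (parts4 r) (Z (cyc r j)) = {Y j, Z (cyc r j)}"
    "merge_class (parts4 r) (U i j a) = {U i j a}"
    "merge_class (parts4 r) (V i j a) = {V i j a}"
    "merge_class (parts4 r) (W i j a) = {W i j a}"
proof -
  show "merge_class (parts4 r) (Y j) = {Y j, Z (cyc r j)}"
    if "j \<in> {1..r}"
    using imageI[OF that] by (intro merge_class_part[OF parts_disjoint(4)]) (simp_all add: parts4_cyc)
  show "merge_class (parts4 r) (Z (cyc r j)) = {Y j, Z (cyc r j)}"
    if "j \<in> {1..r}"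
    using imageI[OF that] by (intro merge_class_part[OF parts_disjoint(4)]) (simp_all add: parts4_cyc)
  show "merge_class (parts4 r) (U i j a) = {U i j a}"
    "merge_class (parts4 r) (V i j a) = {V i j a}"
    "merge_class (parts4 r) (W i j a) = {W i j a}"
    by (auto simp: merge_class_def parts4_cyc)
qed

section \<open>The four merged graphs\<close>

text \<open>Each merged set stays within one kind, so merging multiplies the value of that kind by
  the size of the set: \<open>r\<close> in the first three graphs, 2 in the fourth.\<close>

lemma chi_la_DF:
  fixes r s m c h :: nat
  assumes rs: "r \<ge> 1" "s \<ge> 1"
    and g: "bij_betw g (edges (rDF r s)) {1..10 * (r * s)}"
    and vs: "\<And>x. x \<in> verts (rDF r s) \<Longrightarrow> vertex_sum (rDF r s) g x = by_kind m c h x"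
  shows "distinct [m, r * c, h] \<Longrightarrow> chi_la (DF1 r s) = 3"
    and "distinct [r * m, c, h] \<Longrightarrow> chi_la (DF2 r s) = 3"
    and "distinct [m, c, r * h] \<Longrightarrow> chi_la (DF3 r s) = 3"
    and "distinct [m, c, 2 * h] \<Longrightarrow> chi_la (DF4 r s) = 3"
proof -
  note simple = simple_graph_DF[of r s, unfolded DF1_def DF2_def DF3_def DF4_def]
  have const: "(\<Sum>y\<in>f ` {1..r}. vertex_sum (rDF r s) g y) = r * k"
    if "inj f" "\<And>j. j \<in> {1..r} \<Longrightarrow> vertex_sum (rDF r s) g (f j) = k" for f k
    using that by (simp add: sum.reindex inj_on_subset[OF that(1)])
  have inj: "inj (\<lambda>k. U i k a)" "inj (\<lambda>k. V i k a)" "inj (\<lambda>k. W i k a)" "inj Y" "inj Z" for i a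
    by (auto intro: injI)
  have vs': "vertex_sum (rDF r s) g (U i j a) = m" "vertex_sum (rDF r s) g (V i j a) = m"
    "vertex_sum (rDF r s) g (W i j a) = c"
    if "i \<in> {1, 2}" "j \<in> {1..r}" "a \<in> {1..s}" for i j a
    using that vs by (simp_all add: verts_rDF_iff)
  have vs'': "vertex_sum (rDF r s) g (Y j) = h" "vertex_sum (rDF r s) g (Z j) = h"
    if "j \<in> {1..r}" for j
    using that vs by (simp_all add: verts_rDF_iff)
  have other: "(if i = 1 then 2 else 1) \<in> {1, 2 :: nat}" for i :: nat by simp
  show "chi_la (DF1 r s) = 3" if dist: "distinct [m, r * c, h]"
    unfolding DF1_def
  proof (rule chi_la_merge_rDF[OF rs _ _ merge_inj_edges(1) simple(1) g _ dist swap_inj swap_verts])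
    show "(\<Sum>y\<in>merge_class (parts1 r s) x. vertex_sum (rDF r s) g y) = by_kind m (r * c) h x"
      if "x \<in> verts (rDF r s)" for x
      using that by (cases rule: verts_rDF_cases)
        (simp_all only: merge_class_parts1 const[OF inj(3)] vs' vs'' by_kind.simps sum.insert
          finite.emptyI empty_iff not_False_eq_True sum.empty add_0_right)
    show "merge_class (parts1 r s) (swap x) = swap ` merge_class (parts1 r s) x"
      if "x \<in> verts (rDF r s)" for x
      using that by (cases rule: verts_rDF_cases)
        (simp_all only: merge_class_parts1 other swap.simps image_insert image_empty image_image)
    show "b (swap x) = (\<not> b x)"
      if "\<And>u v. {u, v} \<in> edges (rDF r s) \<Longrightarrow> b u \<noteq> b v" "x \<in> verts (rDF r s)" for b x
      by (rule swap_flip[OF that(1) rs(2) that(2)])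
  qed (rule parts_disjoint(1) parts_verts; assumption)+
  show "chi_la (DF2 r s) = 3" if dist: "distinct [r * m, c, h]"
    unfolding DF2_def
  proof (rule chi_la_merge_rDF[OF rs _ _ merge_inj_edges(2) simple(2) g _ dist swap_inj swap_verts])
    show "(\<Sum>y\<in>merge_class (parts2 r s) x. vertex_sum (rDF r s) g y) = by_kind (r * m) c h x"
      if "x \<in> verts (rDF r s)" for x
      using that by (cases rule: verts_rDF_cases)
        (simp_all only: merge_class_parts2 const[OF inj(1)] const[OF inj(2)] vs' vs'' by_kind.simps
          sum.insert finite.emptyI empty_iff not_False_eq_True sum.empty add_0_right)
    show "merge_class (parts2 r s) (swap x) = swap ` merge_class (parts2 r s) x"
      if "x \<in> verts (rDF r s)" for x
      using that by (cases rule: verts_rDF_cases)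
        (simp_all only: merge_class_parts2 other swap.simps image_insert image_empty image_image)
    show "b (swap x) = (\<not> b x)"
      if "\<And>u v. {u, v} \<in> edges (rDF r s) \<Longrightarrow> b u \<noteq> b v" "x \<in> verts (rDF r s)" for b x
      by (rule swap_flip[OF that(1) rs(2) that(2)])
  qed (rule parts_disjoint(2) parts_verts; assumption)+
  show "chi_la (DF3 r s) = 3" if dist: "distinct [m, c, r * h]"
    unfolding DF3_def
  proof (rule chi_la_merge_rDF[OF rs _ _ merge_inj_edges(3) simple(3) g _ dist swap_inj swap_verts])
    show "(\<Sum>y\<in>merge_class (parts3 r) x. vertex_sum (rDF r s) g y) = by_kind m c (r * h) x"
      if "x \<in> verts (rDF r s)" for x
      using that by (cases rule: verts_rDF_cases)
        (simp_all only: merge_class_parts3 const[OF inj(4)] const[OF inj(5)] vs' vs'' by_kind.simps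
          sum.insert finite.emptyI empty_iff not_False_eq_True sum.empty add_0_right)
    show "merge_class (parts3 r) (swap x) = swap ` merge_class (parts3 r) x"
      if "x \<in> verts (rDF r s)" for x
      using that by (cases rule: verts_rDF_cases)
        (simp_all only: merge_class_parts3 swap.simps image_insert image_empty image_image)
    show "b (swap x) = (\<not> b x)"
      if "\<And>u v. {u, v} \<in> edges (rDF r s) \<Longrightarrow> b u \<noteq> b v" "x \<in> verts (rDF r s)" for b x
      by (rule swap_flip[OF that(1) rs(2) that(2)])
  qed (rule parts_disjoint(3) parts_verts; assumption)+
  show "chi_la (DF4 r s) = 3" if dist: "distinct [m, c, 2 * h]"
    unfolding DF4_def
  proof (rule chi_la_merge_rDF[OF rs _ _ merge_inj_edges(4) simple(4) g _ dist shift_inj shift_verts])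
    have pair: "(\<Sum>y\<in>{Y j, Z (cyc r j)}. vertex_sum (rDF r s) g y) = 2 * h" if "j \<in> {1..r}" for j
      using vs''(1)[OF that] vs''(2)[OF cyc_in[OF that]] by simp
    show "(\<Sum>y\<in>merge_class (parts4 r) x. vertex_sum (rDF r s) g y) = by_kind m c (2 * h) x"
      if "x \<in> verts (rDF r s)" for x
      using that
    proof (cases rule: verts_rDF_cases)
      case (Z k)
      then obtain j where "j \<in> {1..r}" "k = cyc r j" using cyc_onto by blast
      with Z show ?thesis by (simp only: merge_class_parts4 pair by_kind.simps)
    qed (simp_all only: merge_class_parts4 pair vs' by_kind.simps
          sum.insert finite.emptyI empty_iff not_False_eq_True sum.empty add_0_right)
    show "merge_class (parts4 r) (shift r x) = shift r ` merge_class (parts4 r) x"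
      if "x \<in> verts (rDF r s)" for x
      using that
    proof (cases rule: verts_rDF_cases)
      case (Z k)
      then obtain j where "j \<in> {1..r}" "k = cyc r j" using cyc_onto by blast
      with Z show ?thesis
        by (simp only: merge_class_parts4 shift.simps cyc_in image_insert image_empty)
    qed (simp_all only: merge_class_parts4 cyc_in shift.simps image_insert image_empty)
    show "b (shift r x) = (\<not> b x)"
      if "\<And>u v. {u, v} \<in> edges (rDF r s) \<Longrightarrow> b u \<noteq> b v"
        "\<And>S u v. S \<in> parts4 r \<Longrightarrow> u \<in> S \<Longrightarrow> v \<in> S \<Longrightarrow> b u = b v"
        "x \<in> verts (rDF r s)" for b x
      by (rule shift_flip[OF that(1,2) rs(2) that(3)])
  qed (rule parts_disjoint(4) parts_verts; assumption)+
qed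

theorem theorem2p10:
  fixes r s :: nat
  assumes "r \<ge> 2" and "s \<ge> 1"
  shows "(even s \<and> r * s mod 4 \<noteq> 0 \<longrightarrow> chi_la (DF1 r s) = 3) \<and>
         (even s \<and> r mod 4 \<noteq> 0 \<longrightarrow> chi_la (DF2 r s) = 3) \<and>
         chi_la (DF3 r s) = 3 \<and>
         (even r \<longrightarrow> chi_la (DF4 r s) = 3)"
proof -
  define n where "n = r * s"
  define m where "m = 10 * n + 1"
  have r1: "r \<ge> 1" using assms by simp
  obtain g c where g: "bij_betw g (edges (rDF r s)) {1..10 * (r * s)}"
    and vs: "\<And>x. x \<in> verts (rDF r s) \<Longrightarrow> vertex_sum (rDF r s) g x = by_kind m c (s * (3 * m - c)) x"
    and c: "2 * c = (if even n then 30 * n + 2 else 31 * n + 3)"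
    using rDF_labelling_exists[OF r1 assms(2)] unfolding m_def n_def by blast
  define d where "d = 3 * m - c"
  note chi = chi_la_DF[OF r1 assms(2) g vs, folded d_def]
  have n2: "n \<ge> 2" using mult_le_mono[OF assms] by (simp add: n_def)
  \<comment> \<open>Hence \<open>m\<close> and \<open>c\<close> differ, and they stay different when
    either is multiplied by \<open>r \<ge> 2\<close>. Only the hub value remains to be
    separated.\<close>
  have mc: "m < c" "c < 2 * m" using c n2 by (auto simp: m_def split: if_splits)
  \<comment> \<open>The bound serves both parities; it is an equality for odd
    \<open>n\<close>.\<close>
  have d: "c + d = 3 * m" "29 * n + 3 \<le> 2 * d"
    using c mc by (auto simp: d_def m_def split: if_splits)
  have DF1: "chi_la (DF1 r s) = 3" if s: "even s" and rs: "r * s mod 4 \<noteq> 0"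
  proof (rule chi(1))
    have "even n" using s by (simp add: n_def)
    moreover from this have "c = 15 * n + 1" using c by simp
    ultimately have "odd c" "odd m" by (simp_all add: m_def)
    \<comment> \<open>Otherwise both factors of \<open>r * s\<close> would be even and 4 would
      divide the product.\<close>
    moreover have "odd r" using s rs by (auto elim!: evenE)
    moreover have "2 * c \<le> r * c" using assms(1) by simp
    ultimately show "distinct [m, r * c, s * d]"
      \<comment> \<open>\<open>m\<close> and \<open>r * c\<close> are odd while \<open>s * d\<close> is even\<close>
      using s mc by (auto dest: arg_cong[where f = even])
  qed
  have DF2: "chi_la (DF2 r s) = 3" if s: "even s" and r: "r mod 4 \<noteq> 0"
  proof (rule chi(2))
    have "even n" using s by (simp add: n_def)
    moreover from this have "c = 15 * n + 1" using c by simp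
    ultimately have odd: "odd c" "odd m" by (simp_all add: m_def)
    \<comment> \<open>Here \<open>r * m\<close> and \<open>s * d\<close> may both be even, so they
      are separated modulo 4: \<open>s\<close> and \<open>d\<close> are even, while the odd factor
      \<open>m\<close> adds no power of 2 to \<open>r\<close>.\<close>
    have "even d" using arg_cong[OF d(1), of even] odd by simp
    then have "4 dvd s * d" using s mult_dvd_mono[of 2 s 2 d] by simp
    moreover have "\<not> 4 dvd r * m"
    proof -
      have "coprime (2 ^ 2) m" using odd(2) unfolding coprime_power_left_iff by simp
      then have "4 dvd r * m \<longleftrightarrow> 4 dvd r" by (simp add: coprime_dvd_mult_left_iff)
      then show ?thesis using r by (simp add: dvd_eq_mod_eq_0)
    qed
    ultimately have "r * m \<noteq> s * d" by metis
    moreover have "2 * m \<le> r * m" using assms(1) by simp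
    moreover have "c \<noteq> s * d" using s odd by auto
    ultimately show "distinct [r * m, c, s * d]" using mc by auto
  qed
  \<comment> \<open>For the last two graphs size suffices: the merged hub value is at least
    \<open>2 * (s * d)\<close> and so exceeds \<open>c\<close>, which exceeds
    \<open>m\<close>.\<close>
  have "c < 2 * d"
    using c d(2) n2 by (auto split: if_splits)
  also have "\<dots> \<le> 2 * (s * d)" using assms(2) by simp
  finally have big: "c < 2 * (s * d)" .
  moreover have "2 * (s * d) \<le> r * (s * d)" using assms(1) by simp
  ultimately have big': "c < r * (s * d)" by (rule less_le_trans)
  have "chi_la (DF3 r s) = 3" by (rule chi(3)) (use mc big' in auto)
  moreover have "chi_la (DF4 r s) = 3" by (rule chi(4)) (use mc big in auto)
  ultimately show ?thesis using DF1 DF2 by blast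
qed

end
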